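(* Let $\overline{I}_3$ be the quotient of the universal Bannai--Ito algebra $I_3$ (with generators $X,Y,Z$ and central generators $\omega_X,\omega_Y,\omega_Z$) by the relations $\omega_X=\omega_Y=\omega_Z=\omega$ together with $$X(X^2-4)=0,\qquad Y(Y^2-4)=0,\qquad Z(Z^2-4)=0,$$ $$(\omega+4)(\omega-2)(\omega-8)(\omega-14)=0,$$ $$(X-\omega+16)(X-\omega+10)(X-\omega+8)(X-\omega+6)(X-\omega)(X-\omega-2)(X-\omega-6)=0,$$ $$(Y-\omega+16)(Y-\omega+10)(Y-\omega+8)(Y-\omega+6)(Y-\omega)(Y-\omega-2)(Y-\omega-6)=0,$$ $$(Z-\omega+16)(Z-\omega+10)(Z-\omega+8)(Z-\omega+6)(Z-\omega)(Z-\omega-2)(Z-\omega-6)=0.$$ Then $\overline{I}_3$ is isomorphic to the Brauer algebra $B_3(-1)$. An isomorphism $\Psi:\overline{I}_3\to B_3(-1)$ of unital algebras is given explicitly by $$X\mapsto 2(s_1+e_1),\qquad Y\mapsto 2(s_2+e_2),\qquad Z\mapsto 2s_2(s_1+e_1)s_2=2s_1(s_2+e_2)s_1,$$ and the image of $\omega$ is $$\Psi(\omega)=\{\Psi(X),\Psi(Y)\}-\Psi(X)-\Psi(Y)-\Psi(Z).$$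
   Context: All algebras are unital associative algebras over $\mathbb{C}$, and $\{A,B\}=AB+BA$. The universal Bannai--Ito algebra $I_3$ is the algebra generated by $X,Y,Z$ and three central elements $\omega_X,\omega_Y,\omega_Z$ with defining relations $$\{X,Y\}=X+Y+Z+\omega_Z,\qquad \{X,Z\}=X+Y+Z+\omega_Y,\qquad \{Y,Z\}=X+Y+Z+\omega_X.$$ For a scalar $\eta$, the Brauer algebra $B_3(\eta)$ is the unital algebra generated by $s_1,s_2,e_1,e_2$ with defining relations (for $i=1,2$) $$s_i^2=1,\qquad e_i^2=\eta e_i,\qquad s_ie_i=e_is_i=e_i,$$ $$s_1s_2s_1=s_2s_1s_2,\qquad e_1e_2e_1=e_1,\qquad e_2e_1e_2=e_2,$$ $$s_1e_2e_1=s_2e_1,\qquad e_2e_1s_2=e_2s_1.$$ *)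

theory Defs
  imports Complex_Main "HOL-Library.Poly_Mapping" "HOL-Algebra.QuotRing" "HOL-Algebra.Module"
begin

section \<open>Free algebras\<close>

text \<open>Words are wrapped in a datatype, rather than instantiating \<open>list\<close> itself, because other
  theories (e.g. \<open>HOL-Library.ListVector\<close>) already give \<open>+\<close> on lists a different meaning.\<close>

datatype 'g word = Word "'g list"

instantiation word :: (type) monoid_add
begin

definition zero_word :: "'g word" where
  "zero_word = Word []"

fun plus_word :: "'g word \<Rightarrow> 'g word \<Rightarrow> 'g word" where
  "plus_word (Word u) (Word v) = Word (u @ v)"

instance
proof
  fix a b c :: "'g word"
  show "a + b + c = a + (b + c)"
    by (cases a; cases b; cases c) simp
  show "0 + a = a"
    by (cases a) (simp add: zero_word_def)
  show "a + 0 = a"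
    by (cases a) (simp add: zero_word_def)
qed

end

text \<open>The monoid algebra over the complex numbers of the free monoid on \<open>'g\<close>; the product of
  \<^typ>\<open>'a \<Rightarrow>\<^sub>0 'b\<close> is convolution, so here it is the concatenation product.\<close>

type_synonym 'g free = "'g word \<Rightarrow>\<^sub>0 complex"

definition scalar :: "complex \<Rightarrow> 'g free" where
  "scalar c = Poly_Mapping.single 0 c"

definition gen :: "'g \<Rightarrow> 'g free" where
  "gen g = Poly_Mapping.single (Word [g]) 1"

definition free_algebra :: "(complex, 'g free) module" where
  "free_algebra = \<lparr>carrier = UNIV, mult = (*), one = 1, zero = 0, add = (+),
     smult = (\<lambda>c a. scalar c * a)\<rparr>"


section \<open>Quotients by relations, and isomorphisms\<close>

text \<open>A set of pairs \<open>(l, r)\<close> stands for the relations \<open>l = r\<close>. The ideal they generate is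
  two-sided; being an ideal of a unital algebra, it is closed under scalars.\<close>

definition rel_ideal :: "(complex, 'a) module \<Rightarrow> ('a \<times> 'a) set \<Rightarrow> 'a set" where
  "rel_ideal A R = Idl\<^bsub>A\<^esub> {l \<ominus>\<^bsub>A\<^esub> r | l r. (l, r) \<in> R}"

definition quotient_algebra ::
  "(complex, 'a) module \<Rightarrow> ('a \<times> 'a) set \<Rightarrow> (complex, 'a set) module" where
  "quotient_algebra A R = ring.extend (A Quot rel_ideal A R)
     (module.fields (\<lambda>c K. \<Union>a\<in>K. rel_ideal A R +>\<^bsub>A\<^esub> (c \<odot>\<^bsub>A\<^esub> a)))"

definition quotient_class :: "(complex, 'a) module \<Rightarrow> ('a \<times> 'a) set \<Rightarrow> 'a \<Rightarrow> 'a set" where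
  "quotient_class A R a = rel_ideal A R +>\<^bsub>A\<^esub> a"

text \<open>\<^const>\<open>ring_iso\<close> consists of bijective ring homomorphisms preserving \<open>\<one>\<close>.\<close>

definition algebra_iso ::
  "(complex, 'a) module \<Rightarrow> (complex, 'b) module \<Rightarrow> ('a \<Rightarrow> 'b) set" where
  "algebra_iso A B =
     {h \<in> ring_iso A B. \<forall>c. \<forall>a\<in>carrier A. h (c \<odot>\<^bsub>A\<^esub> a) = c \<odot>\<^bsub>B\<^esub> h a}"

definition anticomm :: "(complex, 'a) module \<Rightarrow> 'a \<Rightarrow> 'a \<Rightarrow> 'a" where
  "anticomm A a b = a \<otimes>\<^bsub>A\<^esub> b \<oplus>\<^bsub>A\<^esub> b \<otimes>\<^bsub>A\<^esub> a"


section \<open>The universal Bannai--Ito algebra\<close>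

datatype bi_gen = GX | GY | GZ | GomX | GomY | GomZ

definition BI_rels :: "(bi_gen free \<times> bi_gen free) set" where
  "BI_rels =
     (let X = gen GX; Y = gen GY; Z = gen GZ;
          omX = gen GomX; omY = gen GomY; omZ = gen GomZ
      in {(X * Y + Y * X, X + Y + Z + omZ),
          (X * Z + Z * X, X + Y + Z + omY),
          (Y * Z + Z * Y, X + Y + Z + omX)}
         \<union> {(om * gen g, gen g * om) | om g. om \<in> {omX, omY, omZ}})"

definition BI :: "(complex, bi_gen free set) module" where
  "BI = quotient_algebra free_algebra BI_rels"

definition BI_class :: "bi_gen free \<Rightarrow> bi_gen free set" where
  "BI_class = quotient_class free_algebra BI_rels"


section \<open>The quotient of the Bannai--Ito algebra\<close>

text \<open>The relations are written in the free algebra and then read in \<^const>\<open>BI\<close>. The common value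
  \<open>om\<close> of the three central generators is represented by the first of them.\<close>

definition BI_bar_poly_rels :: "(bi_gen free \<times> bi_gen free) set" where
  "BI_bar_poly_rels =
     (let om = gen GomX
      in {(gen GomX, gen GomY), (gen GomX, gen GomZ)}
         \<union> {(U * (U ^ 2 - 4), 0) | U. U \<in> {gen GX, gen GY, gen GZ}}
         \<union> {((om + 4) * (om - 2) * (om - 8) * (om - 14), 0)}
         \<union> {((U - om + 16) * (U - om + 10) * (U - om + 8) * (U - om + 6)
              * (U - om) * (U - om - 2) * (U - om - 6), 0) | U. U \<in> {gen GX, gen GY, gen GZ}})"

definition BI_bar_rels :: "(bi_gen free set \<times> bi_gen free set) set" where
  "BI_bar_rels = map_prod BI_class BI_class ` BI_bar_poly_rels"

definition BI_bar :: "(complex, bi_gen free set set) module" where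
  "BI_bar = quotient_algebra BI BI_bar_rels"

definition BI_bar_gen :: "bi_gen \<Rightarrow> bi_gen free set set" where
  "BI_bar_gen g = quotient_class BI BI_bar_rels (BI_class (gen g))"


section \<open>The Brauer algebra on three strands\<close>

datatype brauer_gen = GS1 | GS2 | GE1 | GE2

definition brauer3_rels :: "complex \<Rightarrow> (brauer_gen free \<times> brauer_gen free) set" where
  "brauer3_rels \<eta> =
     (let s1 = gen GS1; s2 = gen GS2; e1 = gen GE1; e2 = gen GE2
      in {(s1 ^ 2, 1), (s2 ^ 2, 1),
          (e1 ^ 2, scalar \<eta> * e1), (e2 ^ 2, scalar \<eta> * e2),
          (s1 * e1, e1), (e1 * s1, e1), (s2 * e2, e2), (e2 * s2, e2),
          (s1 * s2 * s1, s2 * s1 * s2),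
          (e1 * e2 * e1, e1), (e2 * e1 * e2, e2),
          (s1 * e2 * e1, s2 * e1), (e2 * e1 * s2, e2 * s1)})"

definition brauer3 :: "complex \<Rightarrow> (complex, brauer_gen free set) module" where
  "brauer3 \<eta> = quotient_algebra free_algebra (brauer3_rels \<eta>)"

definition brauer3_gen :: "complex \<Rightarrow> brauer_gen \<Rightarrow> brauer_gen free set" where
  "brauer3_gen \<eta> g = quotient_class free_algebra (brauer3_rels \<eta>) (gen g)"

end

theory Submission
  imports Defs
begin

text \<open>
  Since \<open>(s + e)\<^sup>2 = 1 + e\<close> in the Brauer algebra with parameter \<open>- 1\<close>, the inverse map has to be
  \<open>e = x\<^sup>2 - 1\<close>, \<open>s = 1 + x - x\<^sup>2\<close> with \<open>x = X / 2\<close>. That the images satisfy the Brauer relations is checked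
  after multiplying by the four Lagrange idempotents of the central element \<open>\<omega>\<close>. For \<open>\<omega> = 2\<close> and \<open>\<omega> = 14\<close>
  the relation of degree seven forces \<open>x = y = z = 1\<close> and \<open>x = y = z = - 1\<close>; for \<open>\<omega> = - 4\<close> it forces
  \<open>x\<^sup>2 = y\<^sup>2 = z\<^sup>2 = 1\<close>, and then \<open>x + y + z = 0\<close>. For \<open>\<omega> = 8\<close> it gives nothing beyond \<open>x\<^sup>3 = x\<close>, and the
  crucial consequence is \<open>(x\<^sup>2 - 1) (y - z) = 0\<close>, from which everything else follows quickly.
  Conversely, the relations of the quotient of the Bannai--Ito algebra are verified in the Brauer algebra
  by letting both sides act on the span of the fifteen diagrams.
\<close>

text \<open>The four values of \<open>\<omega>\<close> are its eigenvalues on the simple modules of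
  the Brauer algebra: \<open>2\<close> and \<open>14\<close> on the trivial and the sign
  representation of the symmetric group, \<open>- 4\<close> on its two-dimensional representation,
  \<open>8\<close> on the three-dimensional module of diagrams with a fixed bottom half. The cubic
  relation allows \<open>X\<close> only the eigenvalues \<open>0\<close>, \<open>2\<close>,
  \<open>- 2\<close>, and the degree-seven relation keeps those for which
  \<open>X - \<omega>\<close> is a listed root: \<open>2\<close> at \<open>\<omega> = 2\<close>,
  \<open>- 2\<close> at \<open>\<omega> = 14\<close>, both \<open>2\<close> and \<open>- 2\<close>
  at \<open>\<omega> = - 4\<close>, all three at \<open>\<omega> = 8\<close>. The last block is the
  hard one. There \<open>t = x + y + z\<close> replaces \<open>z\<close>, because the anticommutator
  of \<open>t\<close> with a generator involves only that generator, \<open>t\<close> and the unit.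
  Bijectivity comes from two substitutions that are inverse to each other on generators. All
  constants in both presentations are real, so identities can be tested by real linear
  functionals.\<close>

section \<open>Quotients of unital algebras by relations\<close>

text \<open>What a quotient has to know about scalars: acting by \<open>c\<close> is multiplication
  by \<open>c \<odot> \<one>\<close>. Two-sided ideals then absorb scalars, and the property is
  inherited by the quotient, so the construction can be iterated for \<open>BI_bar\<close>.\<close>

definition unital_algebra :: "(complex, 'a) module \<Rightarrow> bool" where
  "unital_algebra A \<longleftrightarrow> ring A \<and>
     (\<forall>c. \<forall>a\<in>carrier A. c \<odot>\<^bsub>A\<^esub> a \<in> carrier A \<and> c \<odot>\<^bsub>A\<^esub> a = (c \<odot>\<^bsub>A\<^esub> \<one>\<^bsub>A\<^esub>) \<otimes>\<^bsub>A\<^esub> a)"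

definition algebra_hom ::
  "(complex, 'a) module \<Rightarrow> (complex, 'b) module \<Rightarrow> ('a \<Rightarrow> 'b) set" where
  "algebra_hom A B =
     {h \<in> ring_hom A B. \<forall>c. \<forall>a\<in>carrier A. h (c \<odot>\<^bsub>A\<^esub> a) = c \<odot>\<^bsub>B\<^esub> h a}"

lemma algebra_hom_closed:
  "h \<in> algebra_hom A B \<Longrightarrow> a \<in> carrier A \<Longrightarrow> h a \<in> carrier B"
  by (auto simp: algebra_hom_def dest: ring_hom_closed)

lemma algebra_hom_compose:
  assumes "g \<in> algebra_hom A B" "h \<in> algebra_hom B C"
  shows "h \<circ> g \<in> algebra_hom A C"
  using assms by (auto simp: algebra_hom_def ring_hom_closed intro: ring_hom_trans)

locale presented_algebra =
  fixes A :: "(complex, 'a) module" and R :: "('a \<times> 'a) set"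
  assumes algebra: "unital_algebra A" and rels: "R \<subseteq> carrier A \<times> carrier A"
begin

abbreviation "I \<equiv> rel_ideal A R"
abbreviation "Q \<equiv> quotient_algebra A R"
abbreviation "q \<equiv> quotient_class A R"

lemma ring: "ring A"
  using algebra by (simp add: unital_algebra_def)

lemma smult_closed: "a \<in> carrier A \<Longrightarrow> c \<odot>\<^bsub>A\<^esub> a \<in> carrier A"
  using algebra unfolding unital_algebra_def by blast

lemma smult_eq_mult: "a \<in> carrier A \<Longrightarrow> c \<odot>\<^bsub>A\<^esub> a = (c \<odot>\<^bsub>A\<^esub> \<one>\<^bsub>A\<^esub>) \<otimes>\<^bsub>A\<^esub> a"
  using algebra unfolding unital_algebra_def by blast

lemma differences_closed: "{l \<ominus>\<^bsub>A\<^esub> r | l r. (l, r) \<in> R} \<subseteq> carrier A"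
proof -
  interpret ring A by (rule ring)
  show ?thesis using rels by auto
qed

lemma ideal: "ideal I A"
proof -
  interpret ring A by (rule ring)
  show ?thesis
    unfolding rel_ideal_def using differences_closed by (rule genideal_ideal)
qed

interpretation ideal I A by (rule ideal)

lemma quotient_sel:
  "carrier Q = carrier (A Quot I)" "mult Q = mult (A Quot I)" "one Q = one (A Quot I)"
  "zero Q = zero (A Quot I)" "add Q = add (A Quot I)"
  "smult Q c K = (\<Union>a\<in>K. I +>\<^bsub>A\<^esub> (c \<odot>\<^bsub>A\<^esub> a))"
  by (simp_all add: quotient_algebra_def ring.extend_def module.fields_def)

lemma ring_quotient: "ring Q"
proof -
  interpret F: ring "A Quot I" by (rule quotient_is_ring)
  have "abelian_group Q"
    by (rule abelian_groupI)
      (auto simp: quotient_sel F.a_ac intro: bexI[where x = "\<ominus>\<^bsub>A Quot I\<^esub> x" for x] F.l_neg)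
  moreover have "Group.monoid Q"
    by (rule monoidI) (auto simp: quotient_sel F.m_assoc)
  ultimately show ?thesis
    by (rule ringI) (auto simp: quotient_sel F.l_distr F.r_distr)
qed

lemma class_ring_hom: "q \<in> ring_hom A Q"
  using rcos_ring_hom
  by (auto simp: ring_hom_def quotient_sel quotient_class_def)

lemma class_surj: "carrier Q = q ` carrier A"
  by (auto simp: quotient_sel quotient_class_def FactRing_simps)

lemma smult_in_ideal: "a \<in> I \<Longrightarrow> c \<odot>\<^bsub>A\<^esub> a \<in> I"
  by (metis I_l_closed a_Hcarr one_closed smult_closed smult_eq_mult)

lemma smult_add:
  assumes "a \<in> carrier A" "b \<in> carrier A"
  shows "c \<odot>\<^bsub>A\<^esub> (a \<oplus>\<^bsub>A\<^esub> b) = c \<odot>\<^bsub>A\<^esub> a \<oplus>\<^bsub>A\<^esub> c \<odot>\<^bsub>A\<^esub> b"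
  using assms smult_eq_mult[of "a \<oplus>\<^bsub>A\<^esub> b" c] smult_eq_mult[of a c] smult_eq_mult[of b c]
    smult_closed[of "\<one>\<^bsub>A\<^esub>" c]
  by (simp add: r_distr del: l_distr)

text \<open>The quotient action is a union over all representatives of a coset. As \<open>I\<close>
  absorbs scalars, every representative contributes the same coset and the union collapses.\<close>

lemma class_smult:
  assumes a: "a \<in> carrier A"
  shows "q (c \<odot>\<^bsub>A\<^esub> a) = c \<odot>\<^bsub>Q\<^esub> q a"
proof -
  have "I +>\<^bsub>A\<^esub> (c \<odot>\<^bsub>A\<^esub> b) = I +>\<^bsub>A\<^esub> (c \<odot>\<^bsub>A\<^esub> a)" if "b \<in> I +>\<^bsub>A\<^esub> a" for b
  proof -
    have "\<exists>i\<in>I. b = i \<oplus>\<^bsub>A\<^esub> a"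
      using that by (simp only: a_r_coset_def' UN_iff singleton_iff)
    then obtain i where i: "i \<in> I" "b = i \<oplus>\<^bsub>A\<^esub> a"
      by (rule bexE)
    have "c \<odot>\<^bsub>A\<^esub> b = c \<odot>\<^bsub>A\<^esub> i \<oplus>\<^bsub>A\<^esub> c \<odot>\<^bsub>A\<^esub> a"
      unfolding i(2) using smult_add[OF a_Hcarr[OF i(1)] a] .
    moreover have "c \<odot>\<^bsub>A\<^esub> i \<oplus>\<^bsub>A\<^esub> c \<odot>\<^bsub>A\<^esub> a \<in> I +>\<^bsub>A\<^esub> (c \<odot>\<^bsub>A\<^esub> a)"
      unfolding a_r_coset_def' by (rule UN_I[OF smult_in_ideal[OF i(1)]]) simp
    ultimately have "c \<odot>\<^bsub>A\<^esub> b \<in> I +>\<^bsub>A\<^esub> (c \<odot>\<^bsub>A\<^esub> a)"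
      by (simp only:)
    then show ?thesis
      by (rule a_repr_independence[OF _ smult_closed[OF a] a_subgroup, symmetric])
  qed
  then have "(\<Union>b\<in>I +>\<^bsub>A\<^esub> a. I +>\<^bsub>A\<^esub> (c \<odot>\<^bsub>A\<^esub> b)) = (\<Union>b\<in>I +>\<^bsub>A\<^esub> a. I +>\<^bsub>A\<^esub> (c \<odot>\<^bsub>A\<^esub> a))"
    by (rule SUP_cong[OF refl])
  also have "\<dots> = I +>\<^bsub>A\<^esub> (c \<odot>\<^bsub>A\<^esub> a)"
    using a_rcos_self[OF a] by blast
  finally show ?thesis
    by (simp only: quotient_sel quotient_class_def)
qed

lemma class_hom: "q \<in> algebra_hom A Q"
  unfolding algebra_hom_def using class_ring_hom class_smult by auto

lemma class_closed: "a \<in> carrier A \<Longrightarrow> q a \<in> carrier Q"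
  by (rule algebra_hom_closed[OF class_hom])

lemma unital_algebra_quotient: "unital_algebra Q"
  unfolding unital_algebra_def
proof (intro conjI ring_quotient allI ballI)
  fix c K
  assume "K \<in> carrier Q"
  then obtain a where K: "K = q a" and a: "a \<in> carrier A"
    unfolding class_surj by (rule imageE)
  show "c \<odot>\<^bsub>Q\<^esub> K \<in> carrier Q"
    unfolding K class_smult[OF a, symmetric] by (rule class_closed[OF smult_closed[OF a]])
  have "c \<odot>\<^bsub>Q\<^esub> q a = q ((c \<odot>\<^bsub>A\<^esub> \<one>\<^bsub>A\<^esub>) \<otimes>\<^bsub>A\<^esub> a)"
    unfolding class_smult[OF a, symmetric] by (subst smult_eq_mult[OF a]) (rule refl)
  also have "\<dots> = q (c \<odot>\<^bsub>A\<^esub> \<one>\<^bsub>A\<^esub>) \<otimes>\<^bsub>Q\<^esub> q a"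
    by (rule ring_hom_mult[OF class_ring_hom smult_closed[OF one_closed] a])
  also have "q (c \<odot>\<^bsub>A\<^esub> \<one>\<^bsub>A\<^esub>) = c \<odot>\<^bsub>Q\<^esub> \<one>\<^bsub>Q\<^esub>"
    unfolding class_smult[OF one_closed] ring_hom_one[OF class_ring_hom] ..
  finally show "c \<odot>\<^bsub>Q\<^esub> K = (c \<odot>\<^bsub>Q\<^esub> \<one>\<^bsub>Q\<^esub>) \<otimes>\<^bsub>Q\<^esub> K"
    unfolding K .
qed

lemma class_eq_iff:
  assumes "a \<in> carrier A" "b \<in> carrier A"
  shows "q a = q b \<longleftrightarrow> a \<ominus>\<^bsub>A\<^esub> b \<in> I"
  using assms quotient_eq_iff_same_a_r_cos[OF ideal] by (simp add: quotient_class_def)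

lemma class_rel: "(l, r) \<in> R \<Longrightarrow> q l = q r"
proof -
  assume lr: "(l, r) \<in> R"
  have "l \<ominus>\<^bsub>A\<^esub> r \<in> I"
    unfolding rel_ideal_def using lr genideal_self[OF differences_closed] by blast
  then show ?thesis
    using lr rels by (subst class_eq_iff) auto
qed

text \<open>Universal property of the quotient. The kernel of \<open>h\<close> is a two-sided ideal
  containing every \<open>l \<ominus> r\<close>, hence contains \<open>I\<close>; so
  \<open>h\<close> is constant on classes, and \<open>h'\<close> may evaluate it at an arbitrarily
  chosen representative.\<close>

lemma hom_factors:
  assumes S: "unital_algebra S" and h: "h \<in> algebra_hom A S"
    and hR: "\<And>l r. (l, r) \<in> R \<Longrightarrow> h l = h r"
  obtains h' where "h' \<in> algebra_hom Q S" "\<And>a. a \<in> carrier A \<Longrightarrow> h' (q a) = h a"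
proof -
  interpret S: ring S using S by (simp add: unital_algebra_def)
  have hr: "h \<in> ring_hom A S"
    using h by (simp add: algebra_hom_def)
  interpret h: ring_hom_ring A S h
    by (rule ring_hom_ringI2[OF ring_axioms S.ring_axioms hr])
  have kernel: "I \<subseteq> a_kernel A S h"
    unfolding rel_ideal_def
  proof (rule genideal_minimal)
    show "ideal (a_kernel A S h) A"
      by (rule h.kernel_is_ideal)
    show "{l \<ominus>\<^bsub>A\<^esub> r | l r. (l, r) \<in> R} \<subseteq> a_kernel A S h"
    proof
      fix d assume "d \<in> {l \<ominus>\<^bsub>A\<^esub> r | l r. (l, r) \<in> R}"
      then obtain l r where d: "d = l \<ominus>\<^bsub>A\<^esub> r" and lr: "(l, r) \<in> R"
        unfolding mem_Collect_eq by (elim exE conjE)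
      have closed: "l \<in> carrier A" "r \<in> carrier A"
        using subsetD[OF rels lr] by simp_all
      then have "h d = h l \<ominus>\<^bsub>S\<^esub> h r"
        by (simp add: d a_minus_def)
      also have "\<dots> = \<zero>\<^bsub>S\<^esub>"
        using closed hR[OF lr] by (simp add: a_minus_def S.r_neg)
      finally have "h d = \<zero>\<^bsub>S\<^esub>" .
      moreover have "d \<in> carrier A"
        using closed by (simp add: d)
      ultimately show "d \<in> a_kernel A S h"
        unfolding a_kernel_def' by (intro CollectI conjI)
    qed
  qed
  have eq: "h a = h b" if ab: "a \<in> carrier A" "b \<in> carrier A" "q a = q b" for a b
  proof -
    have "a \<ominus>\<^bsub>A\<^esub> b \<in> I"
      using ab class_eq_iff by simp
    then have "h (a \<ominus>\<^bsub>A\<^esub> b) = \<zero>\<^bsub>S\<^esub>"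
      using subsetD[OF kernel] unfolding a_kernel_def' by simp
    then have "h a \<ominus>\<^bsub>S\<^esub> h b = \<zero>\<^bsub>S\<^esub>"
      using ab by (simp add: a_minus_def)
    then show ?thesis
      using ab S.minus_equality[of "h a" "\<ominus>\<^bsub>S\<^esub> h b"] by (simp add: a_minus_def)
  qed
  define h' where "h' K = h (SOME a. a \<in> carrier A \<and> q a = K)" for K
  have h': "h' (q a) = h a" if a: "a \<in> carrier A" for a
  proof -
    have "\<exists>b. b \<in> carrier A \<and> q b = q a"
      using a by blast
    from someI_ex[OF this] show ?thesis
      unfolding h'_def by (intro eq) (simp_all only: a)
  qed
  have "h' \<in> ring_hom Q S"
  proof (rule ring_hom_memI)
    fix K assume "K \<in> carrier Q"
    then obtain a where K: "K = q a" "a \<in> carrier A"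
      unfolding class_surj by (rule imageE)
    then show "h' K \<in> carrier S"
      by (simp add: h')
    fix L assume "L \<in> carrier Q"
    then obtain b where L: "L = q b" "b \<in> carrier A"
      unfolding class_surj by (rule imageE)
    show "h' (K \<otimes>\<^bsub>Q\<^esub> L) = h' K \<otimes>\<^bsub>S\<^esub> h' L"
      using K L by (simp add: h' flip: ring_hom_mult[OF class_ring_hom])
    show "h' (K \<oplus>\<^bsub>Q\<^esub> L) = h' K \<oplus>\<^bsub>S\<^esub> h' L"
      using K L by (simp add: h' flip: ring_hom_add[OF class_ring_hom])
  next
    show "h' \<one>\<^bsub>Q\<^esub> = \<one>\<^bsub>S\<^esub>"
      by (simp add: h' flip: ring_hom_one[OF class_ring_hom])
  qed
  moreover have "h' (c \<odot>\<^bsub>Q\<^esub> K) = c \<odot>\<^bsub>S\<^esub> h' K" if "K \<in> carrier Q" for c K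
  proof -
    from that obtain a where K: "K = q a" "a \<in> carrier A"
      unfolding class_surj by (rule imageE)
    have "h (c \<odot>\<^bsub>A\<^esub> a) = c \<odot>\<^bsub>S\<^esub> h a"
      using h K(2) by (simp add: algebra_hom_def)
    then show ?thesis
      using K by (simp add: h' smult_closed flip: class_smult)
  qed
  ultimately have "h' \<in> algebra_hom Q S"
    by (simp add: algebra_hom_def)
  with h' show ?thesis
    by (rule that[rotated])
qed

end

section \<open>Free algebras\<close>

lemma scalar_add: "scalar (c + d) = scalar c + scalar d"
  by (simp add: scalar_def single_add)

lemma scalar_mult: "scalar (c * d) = scalar c * scalar d"
  by (simp add: scalar_def mult_single)

lemma scalar_1 [simp]: "scalar 1 = 1"
  by (simp add: scalar_def)

lemma scalar_0 [simp]: "scalar 0 = 0"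
  by (simp add: scalar_def)

lemma scalar_numeral: "scalar (numeral k) = numeral k"
  by (simp add: scalar_def)

lemma free_eq_sum: "(a :: 'g free) = (\<Sum>w\<in>Poly_Mapping.keys a. Poly_Mapping.single w (Poly_Mapping.lookup a w))"
  by (rule poly_mapping_eqI) (simp add: lookup_sum lookup_single when_def in_keys_iff)

lemma single_eq_scalar_mult:
  "Poly_Mapping.single (Word gs) c = scalar c * prod_list (map gen gs)"
proof -
  have "prod_list (map gen gs) = Poly_Mapping.single (Word gs) 1"
    by (induction gs) (simp_all add: gen_def mult_single flip: zero_word_def)
  then show ?thesis
    by (simp add: scalar_def mult_single)
qed

lemma scalar_commute: "(a :: 'g free) * scalar c = scalar c * a"
proof -
  have "Poly_Mapping.single w b * scalar c = scalar c * Poly_Mapping.single w b" for w :: "'g word" and b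
    by (simp add: scalar_def mult_single mult.commute)
  then show ?thesis
    by (subst (1 2) free_eq_sum[of a]) (simp add: sum_distrib_left sum_distrib_right)
qed

text \<open>Every element is a finite sum of scalar multiples of words. This reduces the comparison
  of the two composite substitutions with the identity to generators.\<close>

lemma free_induct [case_names scalar gen add mult]:
  assumes "\<And>c. P (scalar c)" "\<And>g. P (gen g)"
    "\<And>a b. P a \<Longrightarrow> P b \<Longrightarrow> P (a + b)" "\<And>a b. P a \<Longrightarrow> P b \<Longrightarrow> P (a * b)"
  shows "P a"
proof -
  have word: "P (prod_list (map gen gs))" for gs
  proof (induction gs)
    case Nil
    show ?case using assms(1)[of 1] by simp
  next
    case (Cons g gs)
    then show ?case by (simp add: assms(2,4))
  qed
  have single: "P (Poly_Mapping.single w c)" for w c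
    by (cases w) (simp add: single_eq_scalar_mult assms(1,4) word)
  have sum: "P (sum f A)" if "\<And>w. P (f w)" for f and A :: "'a word set"
    by (induction A rule: infinite_finite_induct) (use assms(1)[of 0] in \<open>simp_all add: assms(3) that\<close>)
  show ?thesis
    by (subst free_eq_sum[of a]) (rule sum[OF single])
qed

section \<open>Substitution homomorphisms between free algebras\<close>

fun eval_word :: "('g \<Rightarrow> 'h free) \<Rightarrow> 'g word \<Rightarrow> 'h free" where
  "eval_word h (Word gs) = prod_list (map h gs)"

text \<open>The target is again free: both directions of the isomorphism are first substitutions of
  noncommutative polynomials and pass to classes only afterwards.\<close>

definition free_lift :: "('g \<Rightarrow> 'h free) \<Rightarrow> 'g free \<Rightarrow> 'h free" where
  "free_lift h a = (\<Sum>w\<in>Poly_Mapping.keys a. scalar (Poly_Mapping.lookup a w) * eval_word h w)"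

lemma eval_word_0 [simp]: "eval_word h 0 = 1"
  by (simp add: zero_word_def)

lemma eval_word_plus: "eval_word h (v + w) = eval_word h v * eval_word h w"
  by (cases v; cases w) simp

lemma free_lift_superset:
  assumes "finite A" "Poly_Mapping.keys a \<subseteq> A"
  shows "free_lift h a = (\<Sum>w\<in>A. scalar (Poly_Mapping.lookup a w) * eval_word h w)"
  unfolding free_lift_def
  using assms by (intro sum.mono_neutral_left) (auto simp: in_keys_iff)

lemma free_lift_add: "free_lift h (a + b) = free_lift h a + free_lift h b"
proof -
  let ?A = "Poly_Mapping.keys a \<union> Poly_Mapping.keys b"
  have "Poly_Mapping.keys (a + b) \<subseteq> ?A"
    by (rule keys_add)
  then show ?thesis
    by (simp add: free_lift_superset[of ?A] lookup_add scalar_add distrib_right sum.distrib)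
qed

lemma free_lift_single: "free_lift h (Poly_Mapping.single w c) = scalar c * eval_word h w"
  by (simp add: free_lift_def)

lemma free_lift_0 [simp]: "free_lift h 0 = 0"
  by (simp add: free_lift_def)

lemma free_lift_sum: "free_lift h (sum f A) = (\<Sum>x\<in>A. free_lift h (f x))"
  by (induction A rule: infinite_finite_induct) (simp_all add: free_lift_add)

lemma free_lift_mult:
  fixes a b :: "'g free"
  shows "free_lift h (a * b) = free_lift h a * free_lift h b"
proof -
  have single: "free_lift h (Poly_Mapping.single v c * Poly_Mapping.single w d) =
      free_lift h (Poly_Mapping.single v c) * free_lift h (Poly_Mapping.single w d)"
    for v w :: "'g word" and c d
  proof -
    have "eval_word h v * scalar d = scalar d * eval_word h v"
      by (rule scalar_commute)
    then have "eval_word h v * (scalar d * eval_word h w) = scalar d * (eval_word h v * eval_word h w)"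
      by (simp only: flip: mult.assoc)
    then show ?thesis
      by (simp add: mult_single free_lift_single scalar_mult eval_word_plus mult.assoc)
  qed
  have "free_lift h ((\<Sum>v\<in>A. Poly_Mapping.single v (c v)) * (\<Sum>w\<in>B. Poly_Mapping.single w (d w))) =
      free_lift h (\<Sum>v\<in>A. Poly_Mapping.single v (c v)) * free_lift h (\<Sum>w\<in>B. Poly_Mapping.single w (d w))"
    for A B :: "'g word set" and c d
    by (simp add: sum_product free_lift_sum single)
  from this[where c = "Poly_Mapping.lookup a" and A = "Poly_Mapping.keys a"
      and d = "Poly_Mapping.lookup b" and B = "Poly_Mapping.keys b"]
  show ?thesis
    by (simp only: flip: free_eq_sum)
qed

lemma free_lift_scalar [simp]: "free_lift h (scalar c) = scalar c"
  by (simp add: scalar_def[of c] free_lift_single)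

lemma free_lift_gen [simp]: "free_lift h (gen g) = h g"
  by (simp add: gen_def free_lift_single)

lemma free_lift_1 [simp]: "free_lift h 1 = 1"
  using free_lift_scalar[of h 1] by simp

lemma free_lift_numeral [simp]: "free_lift h (numeral k) = numeral k"
  using free_lift_scalar[of h "numeral k"] by (simp add: scalar_numeral)

lemma free_lift_uminus: "free_lift h (- a) = - free_lift h a"
  using free_lift_add[of h a "- a"] by (simp add: eq_neg_iff_add_eq_0 add.commute)

lemma free_lift_diff: "free_lift h (a - b) = free_lift h a - free_lift h b"
  using free_lift_add[of h a "- b"] by (simp add: free_lift_uminus)

lemma free_lift_power: "free_lift h (a ^ n) = free_lift h a ^ n"
  by (induction n) (simp_all add: free_lift_mult)

lemmas free_lift_simps =
  free_lift_add free_lift_diff free_lift_uminus free_lift_mult free_lift_power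

lemma free_algebra_sel [simp]:
  "carrier free_algebra = UNIV" "mult free_algebra = (*)" "one free_algebra = 1"
  "zero free_algebra = 0" "add free_algebra = (+)" "smult free_algebra c a = scalar c * a"
  by (simp_all add: free_algebra_def)

lemma unital_algebra_free: "unital_algebra free_algebra"
proof -
  have "abelian_group free_algebra"
    by (rule abelian_groupI) (auto simp: add.assoc add.commute intro: exI[where x = "- x" for x])
  moreover have "Group.monoid free_algebra"
    by (rule monoidI) (auto simp: mult.assoc)
  ultimately have "ring (free_algebra :: (complex, 'a free) module)"
    by (rule ringI) (auto simp: distrib_left distrib_right)
  then show ?thesis
    by (simp add: unital_algebra_def)
qed

text \<open>Passing to a type makes the algebraic type classes available. The unit is not part of the class
  instance below, because \<^class>\<open>ring_1\<close> would require a proof that the quotient is nontrivial; therefore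
  units appear as explicit elements from here on. This also covers units of corners.\<close>

class relations =
  fixes congruent :: "'a free \<Rightarrow> 'a free \<Rightarrow> bool"
  assumes congruent_equivp: "equivp congruent"
    and congruent_add: "congruent a a' \<Longrightarrow> congruent b b' \<Longrightarrow> congruent (a + b) (a' + b')"
    and congruent_mult: "congruent a a' \<Longrightarrow> congruent b b' \<Longrightarrow> congruent (a * b) (a' * b')"

lemma congruent_refl: "congruent a a"
  by (simp add: congruent_equivp equivp_reflp)

lemma congruent_uminus: "congruent a b \<Longrightarrow> congruent (- a) (- b)"
  using congruent_mult[OF congruent_refl[of "- 1"], of a b] by simp

lemma congruent_diff: "congruent a a' \<Longrightarrow> congruent b b' \<Longrightarrow> congruent (a - b) (a' - b')"
  using congruent_add[OF _ congruent_uminus, of a a' b b'] by simp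

quotient_type (overloaded) 'a alg = "'a::relations free" / congruent
  by (rule congruent_equivp)

text \<open>Scalars are restricted to the reals so that \<open>linarith\<close> can decide
  identities after a real functional is applied.\<close>

instantiation alg :: (relations) real_algebra
begin

lift_definition zero_alg :: "'a alg" is 0 .
lift_definition plus_alg :: "'a alg \<Rightarrow> 'a alg \<Rightarrow> 'a alg" is "(+)" by (rule congruent_add)
lift_definition times_alg :: "'a alg \<Rightarrow> 'a alg \<Rightarrow> 'a alg" is "(*)" by (rule congruent_mult)
lift_definition uminus_alg :: "'a alg \<Rightarrow> 'a alg" is uminus by (rule congruent_uminus)
lift_definition minus_alg :: "'a alg \<Rightarrow> 'a alg \<Rightarrow> 'a alg" is minus by (rule congruent_diff)
lift_definition scaleR_alg :: "real \<Rightarrow> 'a alg \<Rightarrow> 'a alg" is "\<lambda>r a. scalar (complex_of_real r) * a"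
  by (rule congruent_mult[OF congruent_refl])

instance
proof
  fix a b c :: "'a alg" and r t :: real
  show "a + b + c = a + (b + c)" by transfer (simp add: congruent_refl algebra_simps)
  show "a + b = b + a" by transfer (simp add: congruent_refl algebra_simps)
  show "0 + a = a" by transfer (simp add: congruent_refl algebra_simps)
  show "- a + a = 0" by transfer (simp add: congruent_refl algebra_simps)
  show "a - b = a + - b" by transfer (simp add: congruent_refl algebra_simps)
  show "a * b * c = a * (b * c)" by transfer (simp add: congruent_refl algebra_simps)
  show "(a + b) * c = a * c + b * c" by transfer (simp add: congruent_refl algebra_simps)
  show "a * (b + c) = a * b + a * c" by transfer (simp add: congruent_refl algebra_simps)
  show "r *\<^sub>R (a + b) = r *\<^sub>R a + r *\<^sub>R b" by transfer (simp add: congruent_refl algebra_simps)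
  show "(r + t) *\<^sub>R a = r *\<^sub>R a + t *\<^sub>R a"
    by transfer (simp add: congruent_refl algebra_simps scalar_add)
  show "r *\<^sub>R t *\<^sub>R a = (r * t) *\<^sub>R a"
    by transfer (simp add: congruent_refl mult.assoc scalar_mult)
  show "1 *\<^sub>R a = a" by transfer (simp add: congruent_refl)
  show "r *\<^sub>R a * b = r *\<^sub>R (a * b)" by transfer (simp add: congruent_refl mult.assoc)
  show "a * r *\<^sub>R b = r *\<^sub>R (a * b)"
  proof transfer
    fix a b :: "'a free" and r
    have "a * (scalar (complex_of_real r) * b) = scalar (complex_of_real r) * (a * b)"
      by (metis mult.assoc scalar_commute)
    then show "congruent (a * (scalar (complex_of_real r) * b)) (scalar (complex_of_real r) * (a * b))"
      by (simp add: congruent_refl)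
  qed
qed

end

lemmas abs_alg_simps =
  plus_alg.abs_eq[symmetric] minus_alg.abs_eq[symmetric] uminus_alg.abs_eq[symmetric]
  times_alg.abs_eq[symmetric] zero_alg.abs_eq[symmetric]

lemma abs_alg_scalar: "abs_alg (scalar (complex_of_real r) * a) = r *\<^sub>R abs_alg a"
  by (simp add: scaleR_alg.abs_eq)

lemma abs_alg_numeral: "abs_alg (numeral k) = numeral k *\<^sub>R abs_alg 1"
  using abs_alg_scalar[of "numeral k" 1] by (simp add: scalar_numeral)

lemma abs_alg_unit_left: "abs_alg 1 * x = x"
  by transfer (simp add: congruent_refl)

lemma abs_alg_unit_right: "x * abs_alg 1 = x"
  by transfer (simp add: congruent_refl)


section \<open>The block of the eigenvalue 8\<close>

text \<open>Turns a linear identity between noncommutative monomials into real linear arithmetic.\<close>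

lemma eq_by_functionals:
  fixes a b :: "'v::real_vector"
  assumes "\<And>f :: 'v \<Rightarrow> real. linear f \<Longrightarrow> f a = f b"
  shows "a = b"
proof (rule ccontr)
  assume "a \<noteq> b"
  then have "independent {a - b}"
    by simp
  from linear_independent_extend[OF this, of "\<lambda>_. 1 :: real"]
  obtain f :: "'v \<Rightarrow> real" where "linear f" "f (a - b) = 1"
    by auto
  with assms[of f] show False
    by (simp add: linear_diff)
qed

lemmas expand = mult.assoc distrib_left distrib_right left_diff_distrib right_diff_distrib
  scaleR_right_distrib scaleR_right_diff_distrib mult_scaleR_left mult_scaleR_right
  mult_minus_left mult_minus_right scaleR_minus_right mult_zero_left mult_zero_right

lemma linear_scaleR_real: "linear f \<Longrightarrow> f (r *\<^sub>R v) = r * (f v :: real)"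
  by (simp add: linear_scale)

lemmas linear_simps = linear_add linear_diff linear_scaleR_real linear_0 linear_neg

text \<open>The generators are halved: \<open>x = X / 2\<close> and so on, and \<open>u\<close> is the idempotent of the block.\<close>

locale bi_main_block =
  fixes x y z u :: "'a::real_algebra"
  assumes unit: "u * x = x" "x * u = x" "u * y = y" "y * u = y" "u * z = z" "z * u = z" "u * u = u"
    and cube_x: "x * (x * x) = x" and cube_y: "y * (y * y) = y" and cube_z: "z * (z * z) = z"
    and anticomm_xy: "2 *\<^sub>R (x * y + y * x) = x + y + z + 4 *\<^sub>R u"
    and anticomm_xz: "2 *\<^sub>R (x * z + z * x) = x + y + z + 4 *\<^sub>R u"
    and anticomm_yz: "2 *\<^sub>R (y * z + z * y) = x + y + z + 4 *\<^sub>R u"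
begin

text \<open>In the Brauer algebra this is \<open>e1 * y = e1 * z\<close>. The proof is a
  noncommutative Groebner computation: after \<open>z = t - x - y\<close>, the rules
  \<open>yx\<close>, \<open>tx\<close>, \<open>ty\<close> sort every word into powers of
  \<open>x\<close>, then \<open>y\<close>, then \<open>t\<close>. Overlaps of rules, reduced in two
  ways, give new relations, and the claim is a real linear combination of these.\<close>

lemma square_anticomm_difference: "(x * x - u) * (y - z) = 0"
proof -
  define t where "t = x + y + z"
  have z: "z = t - x - y"
    by (simp add: t_def)
  have tu: "u * t = t" "t * u = t"
    by (simp_all add: t_def unit distrib_left distrib_right)
  have unit_mult: "u * (x * w) = x * w" "u * (y * w) = y * w" "u * (t * w) = t * w"
    "u * (u * w) = u * w" for w
    by (simp_all add: unit tu flip: mult.assoc)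
  have yx: "y * x = (1/2) *\<^sub>R t + 2 *\<^sub>R u - x * y"
  proof (rule eq_by_functionals)
    fix f :: "'a \<Rightarrow> real" assume f: "linear f"
    show "f (y * x) = f ((1/2) *\<^sub>R t + 2 *\<^sub>R u - x * y)"
      using arg_cong[OF anticomm_xy, of f]
      by (simp only: expand linear_simps[OF f] t_def; linarith)
  qed
  have tx: "t * x = 2 *\<^sub>R (x * x) + t + 4 *\<^sub>R u - x * t"
  proof (rule eq_by_functionals)
    fix f :: "'a \<Rightarrow> real" assume f: "linear f"
    show "f (t * x) = f (2 *\<^sub>R (x * x) + t + 4 *\<^sub>R u - x * t)"
      using arg_cong[OF anticomm_xy, of f] arg_cong[OF anticomm_xz, of f]
      by (simp only: expand linear_simps[OF f] t_def; linarith)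
  qed
  have ty: "t * y = 2 *\<^sub>R (y * y) + t + 4 *\<^sub>R u - y * t"
  proof (rule eq_by_functionals)
    fix f :: "'a \<Rightarrow> real" assume f: "linear f"
    show "f (t * y) = f (2 *\<^sub>R (y * y) + t + 4 *\<^sub>R u - y * t)"
      using arg_cong[OF anticomm_xy, of f] arg_cong[OF anticomm_yz, of f]
      by (simp only: expand linear_simps[OF f] t_def; linarith)
  qed
  have swap_mult:
    "y * (x * w) = ((1/2) *\<^sub>R t + 2 *\<^sub>R u - x * y) * w"
    "t * (x * w) = (2 *\<^sub>R (x * x) + t + 4 *\<^sub>R u - x * t) * w"
    "t * (y * w) = (2 *\<^sub>R (y * y) + t + 4 *\<^sub>R u - y * t) * w" for w
    by (simp_all only: yx tx ty flip: mult.assoc)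
  note swaps = yx tx ty swap_mult
  have cube_mult: "x * (x * (x * w)) = x * w" "y * (y * (y * w)) = y * w" for w
    using arg_cong[OF cube_x, of "\<lambda>v. v * w"] arg_cong[OF cube_y, of "\<lambda>v. v * w"]
    by (simp_all only: mult.assoc)
  note rules = expand unit tu unit_mult swaps cube_x cube_y cube_mult


  have square_mult_t: "v * (v * t) = v * t - 2 *\<^sub>R (v * v) + 2 *\<^sub>R v"
    if v: "v * (v * v) = v" "u * v = v" "v * u = v"
      and tv: "t * v = 2 *\<^sub>R (v * v) + t + 4 *\<^sub>R u - v * t" for v
  proof (rule eq_by_functionals)
    fix f :: "'a \<Rightarrow> real" assume f: "linear f"
    have v_mult: "v * (v * (v * w)) = v * w" "u * (v * w) = v * w"
      "t * (v * w) = (2 *\<^sub>R (v * v) + t + 4 *\<^sub>R u - v * t) * w" for w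
      by (simp_all only: v tv flip: mult.assoc) (simp only: v mult.assoc)
    \<comment> \<open>The overlap of \<open>v * v * v = v\<close> with the rule moving
      \<open>t\<close> past \<open>v\<close>: moving \<open>t\<close> through all three factors must
      agree with moving it through one.\<close>
    have "f (t * (v * (v * v))) = f (t * v)"
      by (simp only: v)
    then show "f (v * (v * t)) = f (v * t - 2 *\<^sub>R (v * v) + 2 *\<^sub>R v)"
      by (simp only: expand unit tu unit_mult v(2,3) v_mult(2,3) tv linear_simps[OF f];
          simp only: v v_mult;
          linarith)
  qed
  have xxt: "x * (x * t) = x * t - 2 *\<^sub>R (x * x) + 2 *\<^sub>R x"
    by (rule square_mult_t[OF cube_x unit(1,2) tx])
  have yyt: "y * (y * t) = y * t - 2 *\<^sub>R (y * y) + 2 *\<^sub>R y"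
    by (rule square_mult_t[OF cube_y unit(3,4) ty])
  have tz: "t * z = 2 *\<^sub>R (z * z) + t + 4 *\<^sub>R u - z * t"
  proof (rule eq_by_functionals)
    fix f :: "'a \<Rightarrow> real" assume f: "linear f"
    show "f (t * z) = f (2 *\<^sub>R (z * z) + t + 4 *\<^sub>R u - z * t)"
      using arg_cong[OF anticomm_xz, of f] arg_cong[OF anticomm_yz, of f]
      by (simp only: expand linear_simps[OF f] t_def; linarith)
  qed
  have zzt: "z * (z * t) = z * t - 2 *\<^sub>R (z * z) + 2 *\<^sub>R z"
    by (rule square_mult_t[OF cube_z unit(5,6) tz])
  have zz: "z * z = t * t - (3/2) *\<^sub>R t - 6 *\<^sub>R u - x * x - y * y"
  proof (rule eq_by_functionals)
    fix f :: "'a \<Rightarrow> real" assume f: "linear f"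
    show "f (z * z) = f (t * t - (3/2) *\<^sub>R t - 6 *\<^sub>R u - x * x - y * y)"
      by (simp only: z rules linear_simps[OF f]; linarith)
  qed
  have square_mult_t_mult: "x * (x * (t * w)) = (x * t - 2 *\<^sub>R (x * x) + 2 *\<^sub>R x) * w"
    "y * (y * (t * w)) = (y * t - 2 *\<^sub>R (y * y) + 2 *\<^sub>R y) * w" for w
    by (simp_all only: mult.assoc flip: xxt yyt)
  have ttt: "t * (t * t) = (1/2) *\<^sub>R (t * t) + 11 *\<^sub>R t + 12 *\<^sub>R u"
  proof (rule eq_by_functionals)
    fix f :: "'a \<Rightarrow> real" assume f: "linear f"
    \<comment> \<open>This is \<open>zzt\<close> with \<open>z * z\<close> replaced by its value
      \<open>zz\<close>; by \<open>xxt\<close> and \<open>yyt\<close> all terms in \<open>x\<close>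
      and \<open>y\<close> cancel, leaving a cubic equation for \<open>t\<close> alone.\<close>
    have "f ((t * t - (3/2) *\<^sub>R t - 6 *\<^sub>R u - x * x - y * y) * t) = f (z * t - 2 *\<^sub>R (z * z) + 2 *\<^sub>R z)"
      by (simp only: zzt mult.assoc flip: zz)
    then show "f (t * (t * t)) = f ((1/2) *\<^sub>R (t * t) + 11 *\<^sub>R t + 12 *\<^sub>R u)"
      by (simp only: zz;
          simp only: z rules xxt yyt square_mult_t_mult linear_simps[OF f];
          linarith)
  qed
  note low = xxt yyt square_mult_t_mult ttt
  have z_cube: "x * (t * t) + y * (t * t) = 6 *\<^sub>R u + 6 *\<^sub>R x + 6 *\<^sub>R y + (5/2) *\<^sub>R t + x * x - t * t
      + (3/2) *\<^sub>R (x * t) + (5/2) *\<^sub>R (y * t) + x * (x * y) + x * (y * y)"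
  proof (rule eq_by_functionals)
    fix f :: "'a \<Rightarrow> real" assume f: "linear f"
    \<comment> \<open>The relation \<open>z * z * z = z\<close>, written in \<open>x\<close>,
      \<open>y\<close>, \<open>t\<close> by means of \<open>zz\<close>.\<close>
    have "f (z * (t * t - (3/2) *\<^sub>R t - 6 *\<^sub>R u - x * x - y * y)) = f z"
      by (simp only: cube_z flip: zz)
    then show "f (x * (t * t) + y * (t * t)) =
        f (6 *\<^sub>R u + 6 *\<^sub>R x + 6 *\<^sub>R y + (5/2) *\<^sub>R t + x * x - t * t
      + (3/2) *\<^sub>R (x * t) + (5/2) *\<^sub>R (y * t) + x * (x * y) + x * (y * y))"
      by (simp only: z rules low linear_simps[OF f];
          linarith)
  qed
  show ?thesis
  proof (rule eq_by_functionals)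
    fix f :: "'a \<Rightarrow> real" assume f: "linear f"
    \<comment> \<open>Five consequences yield the claim linearly: the overlaps of \<open>ttt\<close>
      with \<open>x\<close> and with \<open>y\<close>, the relation \<open>z_cube\<close>, and
      \<open>z_cube\<close> multiplied by \<open>x\<close> on the right and by \<open>y\<close> on
      the left.\<close>
    have "f (t * (t * (t * x))) = f (((1/2) *\<^sub>R (t * t) + 11 *\<^sub>R t + 12 *\<^sub>R u) * x)"
      "f (t * (t * (t * y))) = f (((1/2) *\<^sub>R (t * t) + 11 *\<^sub>R t + 12 *\<^sub>R u) * y)"
      by (simp_all only: mult.assoc flip: ttt)
    moreover note arg_cong[OF z_cube, of f] arg_cong[OF z_cube, of "\<lambda>v. f (v * x)"]
      arg_cong[OF z_cube, of "\<lambda>v. f (y * v)"]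
    ultimately show "f ((x * x - u) * (y - z)) = f 0"
      by (simp only: z rules low linear_simps[OF f];
          linarith)
  qed
qed

lemma difference_anticomm:
  "x * (y - z) = - ((y - z) * x)"
proof (rule eq_by_functionals)
  fix f :: "'a \<Rightarrow> real" assume f: "linear f"
  show "f (x * (y - z)) = f (- ((y - z) * x))"
    using arg_cong[OF anticomm_xy, of f] arg_cong[OF anticomm_xz, of f]
    by (simp only: expand linear_simps[OF f]; linarith)
qed

text \<open>Since \<open>x\<close> anticommutes with \<open>y - z\<close>, its square commutes with
  \<open>y - z\<close>, so the factors of the previous identity may be exchanged.\<close>

lemma difference_square_anticomm: "(y - z) * (x * x - u) = 0"
proof -
  have "x * x * (y - z) = x * (- ((y - z) * x))"
    by (simp only: mult.assoc difference_anticomm)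
  also have "\<dots> = (y - z) * (x * x)"
    by (simp only: mult_minus_right flip: mult.assoc) (simp add: difference_anticomm mult.assoc)
  finally have commute: "x * x * (y - z) = (y - z) * (x * x)" .
  have "(y - z) * (x * x - u) = (y - z) * (x * x) - (y - z)"
    by (simp add: left_diff_distrib right_diff_distrib unit)
  also have "\<dots> = (x * x - u) * (y - z)"
    unfolding commute[symmetric] by (simp add: left_diff_distrib right_diff_distrib unit)
  finally show ?thesis
    by (simp only: square_anticomm_difference)
qed

text \<open>Conjugation by the reflection attached to \<open>x\<close> exchanges \<open>y\<close>
  and \<open>z\<close>. Once \<open>square_anticomm_difference\<close> has removed
  \<open>y - z\<close>, what remains is \<open>x * y - z * x = x * x * z - z * x * x\<close>; it
  follows by multiplying \<open>anticomm_xz\<close> by \<open>x\<close> on either side, subtracting,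
  and using that \<open>x\<close> has the same anticommutator with \<open>y\<close> and
  \<open>z\<close>.\<close>

lemma reflection_conj: "(u + x - x * x) * y = z * (u + x - x * x)"
proof (rule eq_by_functionals)
  fix f :: "'a \<Rightarrow> real" assume f: "linear f"
  have "f (x * (2 *\<^sub>R (x * y + y * x))) = f (x * (x + y + z + 4 *\<^sub>R u))"
    by (simp only: anticomm_xy)
  moreover have "f (x * (2 *\<^sub>R (x * z + z * x))) = f (x * (x + y + z + 4 *\<^sub>R u))"
    "f ((2 *\<^sub>R (x * z + z * x)) * x) = f ((x + y + z + 4 *\<^sub>R u) * x)"
    by (simp_all only: anticomm_xz)
  ultimately show "f ((u + x - x * x) * y) = f (z * (u + x - x * x))"
    using arg_cong[OF anticomm_xy, of f] arg_cong[OF anticomm_xz, of f]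
      arg_cong[OF square_anticomm_difference, of f]
    by (simp only: expand unit linear_simps[OF f]; linarith)
qed

text \<open>In front of \<open>e = x * x - u\<close> the elements \<open>y\<close> and
  \<open>z\<close> agree and \<open>x\<close> vanishes. So \<open>anticomm_yz\<close> times
  \<open>e\<close> becomes \<open>y * y + z * z = y + 2\<close> on \<open>e\<close>, which is the
  claim rearranged.\<close>

lemma contraction_mult: "(z * z - u) * (x * x - u) = (u + y - y * y) * (x * x - u)"
proof -
  define e where "e = x * x - u"
  have yz: "z * e = y * e"
    using difference_square_anticomm by (simp add: e_def left_diff_distrib)
  have xe: "x * e = 0"
    by (simp add: e_def right_diff_distrib cube_x unit)
  have ue: "u * e = e"
    by (simp add: e_def right_diff_distrib unit flip: mult.assoc)
  have "2 *\<^sub>R (y * (z * e) + z * (y * e)) = x * e + y * e + z * e + 4 *\<^sub>R (u * e)"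
    using arg_cong[OF anticomm_yz, of "\<lambda>v. v * e"]
    by (simp only: mult.assoc distrib_right mult_scaleR_left)
  then have *: "2 *\<^sub>R (y * (y * e) + z * (z * e)) = 2 *\<^sub>R (y * e) + 4 *\<^sub>R e"
    by (simp add: yz xe ue scaleR_2)
  have "(z * z - u) * e = (u + y - y * y) * e"
  proof (rule eq_by_functionals)
    fix f :: "'a \<Rightarrow> real" assume f: "linear f"
    show "f ((z * z - u) * e) = f ((u + y - y * y) * e)"
      using arg_cong[OF *, of f]
      by (simp only: expand ue linear_simps[OF f]; linarith)
  qed
  then show ?thesis
    by (simp only: e_def)
qed

lemma contraction_mult': "(x * x - u) * (z * z - u) = (x * x - u) * (u + y - y * y)"
proof -
  define e where "e = x * x - u"
  have yz: "e * z = e * y"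
    using square_anticomm_difference by (simp add: e_def right_diff_distrib)
  have xe: "e * x = 0"
    by (simp add: e_def left_diff_distrib cube_x unit mult.assoc)
  have ue: "e * u = e"
    by (simp add: e_def left_diff_distrib unit mult.assoc)
  have "2 *\<^sub>R (e * y * z + e * z * y) = e * x + e * y + e * z + 4 *\<^sub>R (e * u)"
    using arg_cong[OF anticomm_yz, of "\<lambda>v. e * v"]
    by (simp only: mult.assoc distrib_left mult_scaleR_right)
  then have *: "2 *\<^sub>R (e * z * z + e * y * y) = 2 *\<^sub>R (e * y) + 4 *\<^sub>R e"
    by (simp add: yz xe ue scaleR_2)
  have "e * (z * z - u) = e * (u + y - y * y)"
  proof (rule eq_by_functionals)
    fix f :: "'a \<Rightarrow> real" assume f: "linear f"
    show "f (e * (z * z - u)) = f (e * (u + y - y * y))"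
      using arg_cong[OF *, of f]
      by (simp only: expand ue linear_simps[OF f]; linarith)
  qed
  then show ?thesis
    by (simp only: e_def)
qed

text \<open>Between two copies of \<open>e\<close> every outer \<open>x\<close> dies, an outer
  \<open>z\<close> may be replaced by \<open>y\<close>, and \<open>e * e = - e\<close>. Then
  \<open>anticomm_xy\<close> gives \<open>e * y * e = 2 *\<^sub>R e\<close>, and
  \<open>anticomm_yz\<close> gives \<open>e * y * y * e = 0\<close>.\<close>

lemma contraction_sandwich: "(x * x - u) * (y * y - u) * (x * x - u) = x * x - u"
proof -
  define e where "e = x * x - u"
  have yz: "z * e = y * e"
    using difference_square_anticomm by (simp add: e_def left_diff_distrib)
  have zy: "e * z = e * y"
    using square_anticomm_difference by (simp add: e_def right_diff_distrib)
  have xe: "x * e = 0" "e * x = 0"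
    by (simp_all add: e_def right_diff_distrib left_diff_distrib cube_x unit mult.assoc)
  have ue: "u * e = e" "e * u = e"
    by (simp add: e_def right_diff_distrib unit flip: mult.assoc)
      (simp add: e_def left_diff_distrib unit mult.assoc)
  have "e * e = x * (x * e) - u * e"
    by (subst e_def) (simp only: left_diff_distrib mult.assoc)
  then have ee: "e * e = - e"
    by (simp add: xe ue)
  have *: "2 *\<^sub>R (e * y * x * e + e * x * y * e) = e * x * e + e * y * e + e * z * e + 4 *\<^sub>R (e * u * e)"
    using arg_cong[OF anticomm_xy, of "\<lambda>v. e * v * e"]
    by (simp only: mult.assoc distrib_left distrib_right mult_scaleR_right mult_scaleR_left add.commute)
  have **: "2 *\<^sub>R (e * y * z * e + e * z * y * e) = e * x * e + e * y * e + e * z * e + 4 *\<^sub>R (e * u * e)"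
    using arg_cong[OF anticomm_yz, of "\<lambda>v. e * v * e"]
    by (simp only: mult.assoc distrib_left distrib_right mult_scaleR_right mult_scaleR_left)
  have "e * (y * y - u) * e = e"
  proof (rule eq_by_functionals)
    fix f :: "'a \<Rightarrow> real" assume f: "linear f"
    have "e * (y * (x * e)) = 0" "e * (x * (y * e)) = 0" "e * (x * e) = 0"
       "e * (z * e) = e * (y * e)" "e * (y * (z * e)) = e * (y * (y * e))"
      "e * (z * (y * e)) = e * (y * (y * e))"
      by (simp_all add: xe yz zy flip: mult.assoc)
    then show "f (e * (y * y - u) * e) = f e"
      using arg_cong[OF *, of f] arg_cong[OF **, of f]
      by (simp only: expand ue ee linear_simps[OF f]; linarith)
  qed
  then show ?thesis
    by (simp only: e_def)
qed

end

section \<open>The other blocks\<close>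

text \<open>With \<open>s = u + x - x * x\<close> and \<open>e = x * x - u\<close> attached to
  \<open>x\<close>, \<open>y\<close>, \<open>z\<close> as indices 1, 2, 3, the clauses read
  \<open>s1 y = z s1\<close>, \<open>s2 x = z s2\<close>, \<open>e3 e1 = s2 e1\<close>,
  \<open>e2 e3 = e2 s1\<close>, \<open>e1 e2 e1 = e1\<close>, \<open>e2 e1 e2 = e2\<close>. The unit
  is a parameter so that corners \<open>p * A\<close> can be treated.\<close>

definition brauer_block :: "'a::real_algebra \<Rightarrow> 'a \<Rightarrow> 'a \<Rightarrow> 'a \<Rightarrow> bool" where
  "brauer_block u x y z \<longleftrightarrow>
     (u + x - x * x) * y = z * (u + x - x * x) \<and>
     (u + y - y * y) * x = z * (u + y - y * y) \<and>
     (z * z - u) * (x * x - u) = (u + y - y * y) * (x * x - u) \<and>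
     (y * y - u) * (z * z - u) = (y * y - u) * (u + x - x * x) \<and>
     (x * x - u) * (y * y - u) * (x * x - u) = x * x - u \<and>
     (y * y - u) * (x * x - u) * (y * y - u) = y * y - u"

lemma (in bi_main_block) brauer_block: "brauer_block u x y z"
proof -
  interpret yx: bi_main_block y x z u
    using anticomm_xy anticomm_xz anticomm_yz
    by unfold_locales (simp_all only: unit cube_x cube_y cube_z add_ac)
  show ?thesis
    unfolding brauer_block_def
    using reflection_conj yx.reflection_conj contraction_mult yx.contraction_mult'
      contraction_sandwich yx.contraction_sandwich by blast
qed

text \<open>The block of the eigenvalue \<open>- 4\<close>: the contractions are zero, and once
  \<open>x + y + z = 0\<close> is known all clauses reduce to
  \<open>x * y + y * x = - u\<close>.\<close>

lemma brauer_block_involutions: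
  fixes x y z u :: "'a::real_algebra"
  assumes unit: "u * x = x" "x * u = x" "u * y = y" "y * u = y" "u * z = z" "z * u = z" "u * u = u"
    and square: "x * x = u" "y * y = u" "z * z = u"
    and anticomm: "2 *\<^sub>R (x * y + y * x) = x + y + z - 2 *\<^sub>R u"
      "2 *\<^sub>R (x * z + z * x) = x + y + z - 2 *\<^sub>R u"
  shows "brauer_block u x y z"
proof -
  define t where "t = x + y + z"
  have unit_mult: "u * (x * w) = x * w" "u * (y * w) = y * w" "u * (z * w) = z * w"
    "x * (x * w) = u * w" for w
    by (simp_all add: unit square flip: mult.assoc)
  note rules = expand unit unit_mult square
  have "2 *\<^sub>R (x * t) = t"
  proof (rule eq_by_functionals)
    fix f :: "'a \<Rightarrow> real" assume f: "linear f"
    show "f (2 *\<^sub>R (x * t)) = f t"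
      using arg_cong[OF anticomm(1), of "\<lambda>v. f (x * v)"] arg_cong[OF anticomm(1), of "\<lambda>v. f (v * x)"]
        arg_cong[OF anticomm(1), of f] arg_cong[OF anticomm(2), of f]
      by (simp only: t_def rules linear_simps[OF f]; linarith)
  qed
  moreover have "x * (x * t) = t"
    by (simp add: t_def rules)
  ultimately have four: "2 *\<^sub>R (2 *\<^sub>R t) = t"
    by (metis mult_scaleR_right)
  have t: "t = 0"
  proof (rule eq_by_functionals)
    fix f :: "'a \<Rightarrow> real" assume f: "linear f"
    show "f t = f 0"
      using arg_cong[OF four, of f] by (simp only: linear_simps[OF f]; linarith)
  qed
  have z: "z = - x - y"
    using t by (simp add: t_def algebra_simps eq_neg_iff_add_eq_0)
  have xy: "x * y + y * x = - u"
  proof (rule eq_by_functionals)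
    fix f :: "'a \<Rightarrow> real" assume f: "linear f"
    show "f (x * y + y * x) = f (- u)"
      using arg_cong[OF anticomm(1), of f]
      by (simp only: t_def[symmetric] t expand linear_simps[OF f]; linarith)
  qed
  then have "y * x = - u - x * y"
    by (simp add: eq_diff_eq add.commute)
  then show ?thesis
    by (simp add: brauer_block_def z rules)
qed

lemma brauer_block_scalar:
  fixes x u :: "'a::real_algebra"
  assumes "x = u \<or> x = - u" "u * u = u"
  shows "brauer_block u x x x"
  using assms by (auto simp: brauer_block_def algebra_simps)

text \<open>All copies of the idempotent \<open>p\<close> in a word move to the front and merge, so
  a clause in the corner is \<open>p\<close> times the same clause outside.\<close>

lemma brauer_block_corner:
  fixes x y z u p :: "'a::real_algebra"
  assumes p: "p * p = p" "p * u = p" "u * p = p" "x * p = p * x" "y * p = p * y" "z * p = p * z"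
    and unit: "x * u = x" "y * u = y" "z * u = z" "u * x = x" "u * y = y" "u * z = z" "u * u = u"
  shows "brauer_block p (p * x) (p * y) (p * z) \<longleftrightarrow>
     p * ((u + x - x * x) * y) = p * (z * (u + x - x * x)) \<and>
     p * ((u + y - y * y) * x) = p * (z * (u + y - y * y)) \<and>
     p * ((z * z - u) * (x * x - u)) = p * ((u + y - y * y) * (x * x - u)) \<and>
     p * ((y * y - u) * (z * z - u)) = p * ((y * y - u) * (u + x - x * x)) \<and>
     p * ((x * x - u) * (y * y - u) * (x * x - u)) = p * (x * x - u) \<and>
     p * ((y * y - u) * (x * x - u) * (y * y - u)) = p * (y * y - u)"
proof -
  have p_mult: "x * (p * w) = p * (x * w)" "y * (p * w) = p * (y * w)" "z * (p * w) = p * (z * w)"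
    "p * (p * w) = p * w" "p * (u * w) = p * w" "u * (p * w) = p * w" for w
    by (simp_all only: p flip: mult.assoc)
  have unit_mult: "x * (u * w) = x * w" "y * (u * w) = y * w" "z * (u * w) = z * w" for w
    by (simp_all only: unit flip: mult.assoc)
  show ?thesis
    unfolding brauer_block_def
    by (simp add: expand p p_mult unit unit_mult)
qed

text \<open>With \<open>om\<close> acting as \<open>c\<close>, the words in \<open>X\<close> applied
  to \<open>p\<close> stay in the span of \<open>p\<close>, \<open>X * p\<close>,
  \<open>X * (X * p)\<close>, where the degree-seven product is computed on coefficient triples. The
  conclusions express the greatest common divisor of that product with
  \<open>X^3 - 4 X\<close>.\<close>

lemma degree_seven_on_block:
  fixes X om p u :: "'a::real_algebra"
  assumes cube: "X * (X * (X * p)) = 4 *\<^sub>R (X * p)" and om: "om * p = c *\<^sub>R p"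
    and commute: "om * X = X * om" and unit: "u * p = p" "u * X = X"
    and seven: "(X - om + 16 *\<^sub>R u) * (X - om + 10 *\<^sub>R u) * (X - om + 8 *\<^sub>R u) *
       (X - om + 6 *\<^sub>R u) * (X - om) * (X - om - 2 *\<^sub>R u) * (X - om - 6 *\<^sub>R u) = 0"
  shows "c = - 4 \<Longrightarrow> X * (X * p) = 4 *\<^sub>R p" "c = 2 \<Longrightarrow> X * p = 2 *\<^sub>R p" "c = 14 \<Longrightarrow> X * p = (- 2) *\<^sub>R p"
proof -
  define w where "w a b d = a *\<^sub>R p + b *\<^sub>R (X * p) + d *\<^sub>R (X * (X * p))" for a b d
  have om': "om * (X * v) = X * (om * v)" for v
    by (simp only: commute flip: mult.assoc)
  have unit': "u * (X * v) = X * v" for v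
    by (simp only: unit flip: mult.assoc)
  have Xw: "X * w a b d = w 0 (a + 4 * d) b" for a b d
    by (simp add: w_def distrib_left cube scaleR_left_distrib)
  have omw: "om * w a b d = w (c * a) (c * b) (c * d)" for a b d
    by (simp add: w_def distrib_left om om' mult.commute)
  have uw: "u * w a b d = w a b d" for a b d
    by (simp add: w_def distrib_left unit unit')
  have w_linear: "w a b d + w a' b' d' = w (a + a') (b + b') (d + d')"
    "w a b d - w a' b' d' = w (a - a') (b - b') (d - d')" "r *\<^sub>R w a b d = w (r * a) (r * b) (r * d)"
    for a b d a' b' d' r
    by (simp_all add: w_def scaleR_left_distrib scaleR_left_diff_distrib scaleR_right_distrib)
  have "(X - om + 16 *\<^sub>R u) * ((X - om + 10 *\<^sub>R u) * ((X - om + 8 *\<^sub>R u) *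
       ((X - om + 6 *\<^sub>R u) * ((X - om) * ((X - om - 2 *\<^sub>R u) * ((X - om - 6 *\<^sub>R u) * w 1 0 0)))))) = 0"
    using arg_cong[OF seven, of "\<lambda>v. v * w 1 0 0"] by (simp only: mult.assoc mult_zero_left)
  note eq = this[unfolded distrib_right left_diff_distrib mult_scaleR_left Xw omw uw w_linear]
  show "X * (X * p) = 4 *\<^sub>R p" if c: "c = - 4"
  proof (rule eq_by_functionals)
    fix f :: "'a \<Rightarrow> real" assume f: "linear f"
    show "f (X * (X * p)) = f (4 *\<^sub>R p)"
      using arg_cong[OF eq, of f] unfolding c by (simp add: w_def linear_simps[OF f])
  qed
  \<comment> \<open>For \<open>c = 2\<close> and \<open>c = 14\<close> the common divisor is linear,
    so one residue modulo the cubic is too weak; its multiples by \<open>X\<close> and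
    \<open>X * X\<close> supply the missing equations.\<close>
  have X_eq: "X * w a b d = 0" "X * (X * w a b d) = 0" if "w a b d = 0" for a b d
    using that by simp_all
  note X_eq = X_eq[OF eq, unfolded Xw]
  show "X * p = 2 *\<^sub>R p" if c: "c = 2"
  proof (rule eq_by_functionals)
    fix f :: "'a \<Rightarrow> real" assume f: "linear f"
    show "f (X * p) = f (2 *\<^sub>R p)"
      using arg_cong[OF eq, of f] arg_cong[OF X_eq(1), of f] arg_cong[OF X_eq(2), of f] unfolding c
      by (simp add: w_def linear_simps[OF f])
  qed
  show "X * p = (- 2) *\<^sub>R p" if c: "c = 14"
  proof (rule eq_by_functionals)
    fix f :: "'a \<Rightarrow> real" assume f: "linear f"
    show "f (X * p) = f ((- 2) *\<^sub>R p)"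
      using arg_cong[OF eq, of f] arg_cong[OF X_eq(1), of f] arg_cong[OF X_eq(2), of f] unfolding c
      by (simp add: w_def linear_simps[OF f])
  qed
qed

section \<open>Gluing the blocks\<close>

lemma bi_bar_brauer_block:
  fixes X Y Z om u :: "'a::real_algebra"
  assumes unit: "\<And>v. u * v = v" "\<And>v. v * u = v"
    and central: "om * X = X * om" "om * Y = Y * om" "om * Z = Z * om"
    and anticomm: "X * Y + Y * X = X + Y + Z + om" "X * Z + Z * X = X + Y + Z + om"
      "Y * Z + Z * Y = X + Y + Z + om"
    and cube: "X * (X * X - 4 *\<^sub>R u) = 0" "Y * (Y * Y - 4 *\<^sub>R u) = 0" "Z * (Z * Z - 4 *\<^sub>R u) = 0"
    and quartic: "(om + 4 *\<^sub>R u) * (om - 2 *\<^sub>R u) * (om - 8 *\<^sub>R u) * (om - 14 *\<^sub>R u) = 0"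
    and seven: "\<And>U. U \<in> {X, Y, Z} \<Longrightarrow> (U - om + 16 *\<^sub>R u) * (U - om + 10 *\<^sub>R u) * (U - om + 8 *\<^sub>R u) *
       (U - om + 6 *\<^sub>R u) * (U - om) * (U - om - 2 *\<^sub>R u) * (U - om - 6 *\<^sub>R u) = 0"
  shows "brauer_block u ((1/2) *\<^sub>R X) ((1/2) *\<^sub>R Y) ((1/2) *\<^sub>R Z)"
proof -
  define x y z where xyz: "x = (1/2) *\<^sub>R X" "y = (1/2) *\<^sub>R Y" "z = (1/2) *\<^sub>R Z"
  have XYZ: "X = 2 *\<^sub>R x" "Y = 2 *\<^sub>R y" "Z = 2 *\<^sub>R z"
    by (simp_all add: xyz)
  have cube': "x * (x * x) = x" "y * (y * y) = y" "z * (z * z) = z"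
    using cube by (simp_all add: XYZ right_diff_distrib unit)
  have half: "2 *\<^sub>R v = w + (1/2) *\<^sub>R om" if "4 *\<^sub>R v = 2 *\<^sub>R w + om" for v w
  proof (rule eq_by_functionals)
    fix f :: "'a \<Rightarrow> real" assume f: "linear f"
    show "f (2 *\<^sub>R v) = f (w + (1/2) *\<^sub>R om)"
      using arg_cong[OF that, of f] by (simp only: expand linear_simps[OF f]; linarith)
  qed
  have anticomm': "2 *\<^sub>R (x * y + y * x) = x + y + z + (1/2) *\<^sub>R om"
      "2 *\<^sub>R (x * z + z * x) = x + y + z + (1/2) *\<^sub>R om"
      "2 *\<^sub>R (y * z + z * y) = x + y + z + (1/2) *\<^sub>R om"
    by (rule half; use anticomm in \<open>simp add: XYZ scaleR_right_distrib\<close>)+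
  have central': "om * x = x * om" "om * y = y * om" "om * z = z * om"
    using central by (simp_all add: xyz)

  \<comment> \<open>Halving the generators turns the constant \<open>c\<close> into
    \<open>c/2\<close>, that is \<open>- 2\<close> for \<open>c = - 4\<close> and \<open>4\<close>
    for \<open>c = 8\<close>: the constants in \<open>brauer_block_involutions\<close> and
    \<open>bi_main_block\<close>.\<close>
  have block: "brauer_block p (p * x) (p * y) (p * z)"
    if p: "p * p = p" "x * p = p * x" "y * p = p * y" "z * p = p * z" and om: "om * p = c *\<^sub>R p" "p * om = c *\<^sub>R p"
      and c: "c \<in> {- 4, 2, 8, 14}" for p c
  proof -
    have p_mult: "x * (p * w) = p * (x * w)" "y * (p * w) = p * (y * w)" "z * (p * w) = p * (z * w)"
      "p * (p * w) = p * w" for w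
      by (simp_all only: p flip: mult.assoc)
    note p_rules = p p_mult mult.assoc
    have p_anticomm: "2 *\<^sub>R (p * x * (p * y) + p * y * (p * x)) = p * x + p * y + p * z + (c/2) *\<^sub>R p"
      "2 *\<^sub>R (p * x * (p * z) + p * z * (p * x)) = p * x + p * y + p * z + (c/2) *\<^sub>R p"
      "2 *\<^sub>R (p * y * (p * z) + p * z * (p * y)) = p * x + p * y + p * z + (c/2) *\<^sub>R p"
      using arg_cong[OF anticomm'(1), of "\<lambda>v. p * v"] arg_cong[OF anticomm'(2), of "\<lambda>v. p * v"]
        arg_cong[OF anticomm'(3), of "\<lambda>v. p * v"]
      by (simp_all add: p_rules distrib_left om)
    have Xp: "U * (U * (U * p)) = 4 *\<^sub>R (U * p)" if "U \<in> {X, Y, Z}" for U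
      using that cube' by (auto simp: XYZ p_rules)
    note seven_p = degree_seven_on_block[OF Xp om(1) _ unit(1) unit(1) seven]
    consider "c = - 4" | "c = 2" | "c = 8" | "c = 14"
      using c by blast
    then show ?thesis
    proof cases
      case 1
      have "p * x * (p * x) = p" "p * y * (p * y) = p" "p * z * (p * z) = p"
        using seven_p(1)[OF _ _ _ 1, of X] seven_p(1)[OF _ _ _ 1, of Y] seven_p(1)[OF _ _ _ 1, of Z] central
        by (simp_all add: XYZ p_rules)
      then show ?thesis
        using p_anticomm 1 by (intro brauer_block_involutions) (simp_all add: p_rules)
    next
      case 2
      have "p * x = p" "p * y = p" "p * z = p"
        using seven_p(2)[OF _ _ _ 2, of X] seven_p(2)[OF _ _ _ 2, of Y] seven_p(2)[OF _ _ _ 2, of Z] central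
        by (simp_all add: XYZ p_rules)
      then show ?thesis
        using brauer_block_scalar[of p p] p by simp
    next
      case 3
      interpret bi_main_block "p * x" "p * y" "p * z" p
        using p_anticomm cube' 3 by unfold_locales (simp_all add: p_rules)
      show ?thesis by (rule brauer_block)
    next
      case 4
      have "p * x = - p" "p * y = - p" "p * z = - p"
        using seven_p(3)[OF _ _ _ 4, of X] seven_p(3)[OF _ _ _ 4, of Y] seven_p(3)[OF _ _ _ 4, of Z] central
        by (simp_all add: XYZ p_rules flip: scaleR_minus_right)
      then show ?thesis
        using brauer_block_scalar[of "- p" p] p by simp
    qed
  qed

  \<comment> \<open>Polynomials of degree at most three in \<open>om\<close>, given by coefficients;
    \<open>om_w\<close> is multiplication by \<open>om\<close> modulo the quartic.\<close>
  define w where "w a b d e = a *\<^sub>R u + b *\<^sub>R om + d *\<^sub>R (om * om) + e *\<^sub>R (om * (om * om))" for a b d e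
  have om4: "om * (om * (om * om)) = 896 *\<^sub>R u - 400 *\<^sub>R om - 60 *\<^sub>R (om * om) + 20 *\<^sub>R (om * (om * om))"
  proof (rule eq_by_functionals)
    fix f :: "'a \<Rightarrow> real" assume f: "linear f"
    show "f (om * (om * (om * om))) = f (896 *\<^sub>R u - 400 *\<^sub>R om - 60 *\<^sub>R (om * om) + 20 *\<^sub>R (om * (om * om)))"
      using arg_cong[OF quartic, of f] by (simp only: expand unit linear_simps[OF f]; linarith)
  qed
  have om_w: "om * w a b d e = w (896 * e) (a - 400 * e) (b - 60 * e) (d + 20 * e)" for a b d e
    by (simp add: w_def expand unit om4 algebra_simps)
  have w_om: "w a b d e * v = v * w a b d e" if "om * v = v * om" for a b d e v
    using that by (simp add: w_def expand unit) (simp add: that flip: mult.assoc)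
  have w_mult: "w a b d e * p = (a + b * c + d * c^2 + e * c^3) *\<^sub>R p" if "om * p = c *\<^sub>R p" for a b d e p c
    by (simp add: w_def expand unit that power2_eq_square power3_eq_cube algebra_simps)
  have w_scaleR: "r *\<^sub>R w a b d e = w (r * a) (r * b) (r * d) (r * e)" for r a b d e
    by (simp add: w_def scaleR_right_distrib)
  \<comment> \<open>The conditions \<open>eigen\<close> make the coefficients an eigenvector of
    multiplication by \<open>om\<close>, so the polynomial is a multiple of the product of the other
    three factors of the quartic. The condition \<open>idem\<close> sets its value at
    \<open>c\<close> to \<open>1\<close>, whence idempotence.\<close>
  have w_block: "brauer_block (w a b d e) (w a b d e * x) (w a b d e * y) (w a b d e * z)"
    if c: "c \<in> {- 4, 2, 8, 14}"
      and eigen: "896 * e = c * a" "a - 400 * e = c * b" "b - 60 * e = c * d" "d + 20 * e = c * e"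
      and idem: "a + b * c + d * c^2 + e * c^3 = 1" for a b c d e
  proof (rule block[OF _ _ _ _ _ _ c])
    show om_p: "om * w a b d e = c *\<^sub>R w a b d e"
      by (simp only: om_w w_scaleR eigen)
    show "w a b d e * w a b d e = w a b d e"
      by (simp only: w_mult[OF om_p] idem scaleR_one)
    show "w a b d e * om = c *\<^sub>R w a b d e"
      by (simp only: w_om om_p)
    show "x * w a b d e = w a b d e * x" "y * w a b d e = w a b d e * y" "z * w a b d e = w a b d e * z"
      by (simp_all only: w_om central')
  qed
  define identities where "identities p \<longleftrightarrow>
     p * ((u + x - x * x) * y) = p * (z * (u + x - x * x)) \<and>
     p * ((u + y - y * y) * x) = p * (z * (u + y - y * y)) \<and>
     p * ((z * z - u) * (x * x - u)) = p * ((u + y - y * y) * (x * x - u)) \<and>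
     p * ((y * y - u) * (z * z - u)) = p * ((y * y - u) * (u + x - x * x)) \<and>
     p * ((x * x - u) * (y * y - u) * (x * x - u)) = p * (x * x - u) \<and>
     p * ((y * y - u) * (x * x - u) * (y * y - u)) = p * (y * y - u)" for p
  have corner: "brauer_block (w a b d e) (w a b d e * x) (w a b d e * y) (w a b d e * z) \<longleftrightarrow>
      identities (w a b d e)"
    if "w a b d e * w a b d e = w a b d e" for a b d e
    unfolding identities_def by (rule brauer_block_corner) (simp_all only: that w_om central' unit)
  have w_idem: "w a b d e * w a b d e = w a b d e"
    if "896 * e = c * a" "a - 400 * e = c * b" "b - 60 * e = c * d" "d + 20 * e = c * e"
       "a + b * c + d * c^2 + e * c^3 = 1" for a b c d e
  proof -
    have "om * w a b d e = c *\<^sub>R w a b d e"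
      by (simp only: om_w w_scaleR that)
    from w_mult[OF this] show ?thesis
      by (simp only: that scaleR_one)
  qed
  \<comment> \<open>the Lagrange polynomials in \<open>om\<close> at the nodes \<open>- 4\<close>, \<open>2\<close>, \<open>8\<close>, \<open>14\<close>\<close>
  let ?p1 = "w (224/1296) (- 156/1296) (24/1296) (- 1/1296)"
  let ?p2 = "w (448/432) (24/432) (- 18/432) (1/432)"
  let ?p3 = "w (- 112/432) (36/432) (12/432) (- 1/432)"
  let ?p4 = "w (64/1296) (- 24/1296) (- 6/1296) (1/1296)"
  have identities_w: "identities (w a b d e)"
    if "(a, b, d, e, c) = (224/1296, - 156/1296, 24/1296, - 1/1296, - 4) \<or>
      (a, b, d, e, c) = (448/432, 24/432, - 18/432, 1/432, 2) \<or>
      (a, b, d, e, c) = (- 112/432, 36/432, 12/432, - 1/432, 8) \<or>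
      (a, b, d, e, c) = (64/1296, - 24/1296, - 6/1296, 1/1296, 14)" for a b c d e :: real
  proof -
    have eqs: "896 * e = c * a" "a - 400 * e = c * b" "b - 60 * e = c * d" "d + 20 * e = c * e"
      "a + b * c + d * c^2 + e * c^3 = 1" "c \<in> {- 4, 2, 8, 14}"
      using that by auto
    show ?thesis
      using w_block[OF eqs(6,1-5)] corner[OF w_idem[OF eqs(1-5)]] by blast
  qed
  have "identities ?p1" "identities ?p2" "identities ?p3" "identities ?p4"
    by (rule identities_w[of _ _ _ _ "- 4"] identities_w[of _ _ _ _ 2] identities_w[of _ _ _ _ 8]
        identities_w[of _ _ _ _ 14]; simp)+
  note identities_p = this[unfolded identities_def]
  \<comment> \<open>Lagrange interpolation of the constant \<open>1\<close>: an identity that holds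
    after multiplication by each of the four idempotents therefore holds.\<close>
  have sum: "?p1 + ?p2 + ?p3 + ?p4 = u"
  proof (rule eq_by_functionals)
    fix f :: "'a \<Rightarrow> real" assume f: "linear f"
    show "f (?p1 + ?p2 + ?p3 + ?p4) = f u"
      by (simp only: w_def linear_simps[OF f]; linarith)
  qed
  have glue: "L = R" if "?p1 * L = ?p1 * R" "?p2 * L = ?p2 * R" "?p3 * L = ?p3 * R" "?p4 * L = ?p4 * R" for L R
  proof -
    have "u * L = u * R"
      unfolding sum[symmetric] distrib_right using that by simp
    then show ?thesis by (simp add: unit)
  qed
  have "brauer_block u x y z"
    unfolding brauer_block_def
    by (intro conjI; rule glue; insert identities_p; blast)
  then show ?thesis
    by (simp add: xyz)
qed

section \<open>Computations in the Brauer algebra\<close>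

locale brauer_three =
  fixes s1 s2 e1 e2 u :: "'a::real_algebra"
  assumes unit: "u * v = v" "v * u = v"
    and s_square: "s1 * s1 = u" "s2 * s2 = u"
    and e_square: "e1 * e1 = - e1" "e2 * e2 = - e2"
    and se: "s1 * e1 = e1" "e1 * s1 = e1" "s2 * e2 = e2" "e2 * s2 = e2"
    and braid: "s1 * s2 * s1 = s2 * s1 * s2"
    and eee: "e1 * e2 * e1 = e1" "e2 * e1 * e2 = e2"
    and see: "s1 * e2 * e1 = s2 * e1" and ees: "e2 * e1 * s2 = e2 * s1"
begin

text \<open>Multiply \<open>see\<close> by \<open>e2\<close> on the right and contract
  \<open>e2 * e1 * e2\<close>; \<open>ees'\<close> arises in the same way from \<open>ees\<close>
  and \<open>e1\<close> on the left.\<close>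

lemma see': "s2 * e1 * e2 = s1 * e2"
  by (metis see eee(2) mult.assoc)

lemma ees': "e1 * e2 * s1 = e1 * s2"
  by (metis ees eee(1) mult.assoc)

lemma ese: "e1 * s2 * e1 = e1" "e2 * s1 * e2 = e2"
  by (metis see se(2) eee(1) mult.assoc, metis see' se(4) eee(2) mult.assoc)

text \<open>The fifteen diagrams, listed as the six permutations followed by the three left ideals of
  diagrams with a fixed bottom half.\<close>

definition diagrams :: "'a list" where
  "diagrams = [u, s1, s2, s1 * s2, s2 * s1, s1 * (s2 * s1),
     e1, e2 * e1, s2 * e1, e1 * e2, e2, s1 * e2, e1 * s2, e2 * s1, s2 * (e1 * s2)]"

text \<open>Formal coefficient vectors: equal lists give equal elements, which is the direction used
  to verify relations.\<close>

definition comb :: "real list \<Rightarrow> 'a" where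
  "comb cs = (\<Sum>(c, d)\<leftarrow>zip cs diagrams. c *\<^sub>R d)"

lemma unit_eq_comb: "u = comb [1, 0, 0, 0, 0, 0, 0, 0, 0, 0, 0, 0, 0, 0, 0]"
  by (simp add: comb_def diagrams_def)

lemma zero_eq_comb: "comb [0, 0, 0, 0, 0, 0, 0, 0, 0, 0, 0, 0, 0, 0, 0] = 0"
  by (simp add: comb_def diagrams_def)

lemma comb_add:
  "comb [c0, c1, c2, c3, c4, c5, c6, c7, c8, c9, c10, c11, c12, c13, c14] + comb [d0, d1, d2, d3, d4, d5, d6, d7, d8, d9, d10, d11, d12, d13, d14] = comb [c0 + d0, c1 + d1, c2 + d2, c3 + d3, c4 + d4, c5 + d5, c6 + d6, c7 + d7, c8 + d8, c9 + d9, c10 + d10, c11 + d11, c12 + d12, c13 + d13, c14 + d14]"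
  by (simp add: comb_def diagrams_def scaleR_left_distrib add_ac)

lemma comb_diff:
  "comb [c0, c1, c2, c3, c4, c5, c6, c7, c8, c9, c10, c11, c12, c13, c14] - comb [d0, d1, d2, d3, d4, d5, d6, d7, d8, d9, d10, d11, d12, d13, d14] = comb [c0 - d0, c1 - d1, c2 - d2, c3 - d3, c4 - d4, c5 - d5, c6 - d6, c7 - d7, c8 - d8, c9 - d9, c10 - d10, c11 - d11, c12 - d12, c13 - d13, c14 - d14]"
  by (simp add: comb_def diagrams_def scaleR_left_diff_distrib algebra_simps)

lemma comb_scaleR: "r *\<^sub>R comb [c0, c1, c2, c3, c4, c5, c6, c7, c8, c9, c10, c11, c12, c13, c14] = comb [r * c0, r * c1, r * c2, r * c3, r * c4, r * c5, r * c6, r * c7, r * c8, r * c9, r * c10, r * c11, r * c12, r * c13, r * c14]"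
  by (simp add: comb_def diagrams_def scaleR_right_distrib)

text \<open>Rewrite rules for right-nested products, directed towards the words in
  \<open>diagrams\<close>; the versions with \<open>w\<close> apply in front of further
  factors.\<close>

lemma mult_assoc_rules:
  "s1 * (s1 * w) = w" "s2 * (s2 * w) = w" "e1 * (e1 * w) = - (e1 * w)" "e2 * (e2 * w) = - (e2 * w)"
  "s1 * (e1 * w) = e1 * w" "e1 * (s1 * w) = e1 * w" "s2 * (e2 * w) = e2 * w" "e2 * (s2 * w) = e2 * w"
  "s2 * (s1 * s2) = s1 * (s2 * s1)" "s2 * (s1 * (s2 * w)) = s1 * (s2 * (s1 * w))"
  "e1 * (e2 * e1) = e1" "e1 * (e2 * (e1 * w)) = e1 * w" "e2 * (e1 * e2) = e2" "e2 * (e1 * (e2 * w)) = e2 * w"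
  "s1 * (e2 * e1) = s2 * e1" "s1 * (e2 * (e1 * w)) = s2 * (e1 * w)"
  "s2 * (e1 * e2) = s1 * e2" "s2 * (e1 * (e2 * w)) = s1 * (e2 * w)"
  "e2 * (e1 * s2) = e2 * s1" "e2 * (e1 * (s2 * w)) = e2 * (s1 * w)"
  "e1 * (e2 * s1) = e1 * s2" "e1 * (e2 * (s1 * w)) = e1 * (s2 * w)"
  "e1 * (s2 * e1) = e1" "e1 * (s2 * (e1 * w)) = e1 * w"
  "e2 * (s1 * e2) = e2" "e2 * (s1 * (e2 * w)) = e2 * w"
  using s_square e_square se braid eee see see' ees ees' ese
  by (simp_all only: unit mult_minus_left flip: mult.assoc) 

lemma e_mult_ss: "e1 * (s2 * s1) = e1 * e2" "e2 * (s1 * s2) = e2 * e1" "e1 * (s2 * (s1 * w)) = e1 * (e2 * w)"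
  "e2 * (s1 * (s2 * w)) = e2 * (e1 * w)"
  by (metis ees' s_square unit mult.assoc, metis ees s_square unit mult.assoc,
      metis ees' s_square unit mult.assoc, metis ees s_square unit mult.assoc)

lemma s1_es: "s1 * (e2 * s1) = s2 * (e1 * s2)"
  by (metis ees see mult.assoc)

lemma ss_mult_e: "s1 * (s2 * e1) = e2 * e1" "s2 * (s1 * e2) = e1 * e2"
  "s1 * (s2 * (e1 * w)) = e2 * (e1 * w)" "s2 * (s1 * (e2 * w)) = e1 * (e2 * w)"
  by (metis see s_square unit mult.assoc, metis see' s_square unit mult.assoc,
      metis see s_square unit mult.assoc, metis see' s_square unit mult.assoc)

lemmas diagram_mult = ss_mult_e mult_assoc_rules e_mult_ss s1_es unit s_square e_square se

lemma s1_comb: "s1 * comb [c0, c1, c2, c3, c4, c5, c6, c7, c8, c9, c10, c11, c12, c13, c14] =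
    comb [c1, c0, c3, c2, c5, c4, c6, c8, c7, c9, c11, c10, c12, c14, c13]"
proof (rule eq_by_functionals)
  fix f :: "'a \<Rightarrow> real" assume f: "linear f"
  show "f (s1 * comb [c0, c1, c2, c3, c4, c5, c6, c7, c8, c9, c10, c11, c12, c13, c14]) =
    f (comb [c1, c0, c3, c2, c5, c4, c6, c8, c7, c9, c11, c10, c12, c14, c13])"
    by (simp add: comb_def diagrams_def expand diagram_mult linear_simps[OF f]; simp add: algebra_simps)
qed

lemma s2_comb: "s2 * comb [c0, c1, c2, c3, c4, c5, c6, c7, c8, c9, c10, c11, c12, c13, c14] =
    comb [c2, c4, c0, c5, c1, c3, c8, c7, c6, c11, c10, c9, c14, c13, c12]"
proof (rule eq_by_functionals)
  fix f :: "'a \<Rightarrow> real" assume f: "linear f"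
  show "f (s2 * comb [c0, c1, c2, c3, c4, c5, c6, c7, c8, c9, c10, c11, c12, c13, c14]) =
    f (comb [c2, c4, c0, c5, c1, c3, c8, c7, c6, c11, c10, c9, c14, c13, c12])"
    by (simp add: comb_def diagrams_def expand diagram_mult linear_simps[OF f]; simp add: algebra_simps)
qed

text \<open>Each left ideal of diagrams with a fixed bottom half is sent to its one member beginning
  with \<open>e1\<close>. The minus sign is the loop value \<open>- 1\<close>.\<close>

lemma e1_comb: "e1 * comb [c0, c1, c2, c3, c4, c5, c6, c7, c8, c9, c10, c11, c12, c13, c14] =
    comb [0, 0, 0, 0, 0, 0, c0 + c1 - c6 + c7 + c8, 0, 0, c4 + c5 - c9 + c10 + c11, 0, 0, c2 + c3 - c12 + c13 + c14, 0, 0]"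
proof (rule eq_by_functionals)
  fix f :: "'a \<Rightarrow> real" assume f: "linear f"
  show "f (e1 * comb [c0, c1, c2, c3, c4, c5, c6, c7, c8, c9, c10, c11, c12, c13, c14]) =
    f (comb [0, 0, 0, 0, 0, 0, c0 + c1 - c6 + c7 + c8, 0, 0, c4 + c5 - c9 + c10 + c11, 0, 0, c2 + c3 - c12 + c13 + c14, 0, 0])"
    by (simp add: comb_def diagrams_def expand diagram_mult linear_simps[OF f]; simp add: algebra_simps)
qed

lemma e2_comb: "e2 * comb [c0, c1, c2, c3, c4, c5, c6, c7, c8, c9, c10, c11, c12, c13, c14] =
    comb [0, 0, 0, 0, 0, 0, 0, c3 + c5 + c6 - c7 + c8, 0, 0, c0 + c2 + c9 - c10 + c11, 0, 0, c1 + c4 + c12 - c13 + c14, 0]"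
proof (rule eq_by_functionals)
  fix f :: "'a \<Rightarrow> real" assume f: "linear f"
  show "f (e2 * comb [c0, c1, c2, c3, c4, c5, c6, c7, c8, c9, c10, c11, c12, c13, c14]) =
    f (comb [0, 0, 0, 0, 0, 0, 0, c3 + c5 + c6 - c7 + c8, 0, 0, c0 + c2 + c9 - c10 + c11, 0, 0, c1 + c4 + c12 - c13 + c14, 0])"
    by (simp add: comb_def diagrams_def expand diagram_mult linear_simps[OF f]; simp add: algebra_simps)
qed

lemmas comb_simps = comb_add comb_diff comb_scaleR s1_comb s2_comb e1_comb e2_comb

section \<open>The images of the Bannai--Ito generators and their action on diagrams\<close>

definition "X = 2 *\<^sub>R (s1 + e1)"
definition "Y = 2 *\<^sub>R (s2 + e2)"
definition "Z = 2 *\<^sub>R (s2 * (s1 + e1) * s2)"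
definition "om = X * Y + Y * X - X - Y - Z"

lemma X_comb: "X * comb [c0, c1, c2, c3, c4, c5, c6, c7, c8, c9, c10, c11, c12, c13, c14] =
    comb [2 * c1, 2 * c0, 2 * c3, 2 * c2, 2 * c5, 2 * c4, 2 * c0 + 2 * c1 + 2 * c7 + 2 * c8, 2 * c8, 2 * c7, 2 * c4 + 2 * c5 + 2 * c10 + 2 * c11, 2 * c11, 2 * c10, 2 * c2 + 2 * c3 + 2 * c13 + 2 * c14, 2 * c14, 2 * c13]"
  by (simp only: X_def mult.assoc distrib_right left_diff_distrib mult_scaleR_left comb_simps;
    simp add: algebra_simps)

lemma Y_comb: "Y * comb [c0, c1, c2, c3, c4, c5, c6, c7, c8, c9, c10, c11, c12, c13, c14] =
    comb [2 * c2, 2 * c4, 2 * c0, 2 * c5, 2 * c1, 2 * c3, 2 * c8, 2 * c3 + 2 * c5 + 2 * c6 + 2 * c8, 2 * c6, 2 * c11, 2 * c0 + 2 * c2 + 2 * c9 + 2 * c11, 2 * c9, 2 * c14, 2 * c1 + 2 * c4 + 2 * c12 + 2 * c14, 2 * c12]"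
  by (simp only: Y_def mult.assoc distrib_right left_diff_distrib mult_scaleR_left comb_simps;
    simp add: algebra_simps)

lemma Z_comb: "Z * comb [c0, c1, c2, c3, c4, c5, c6, c7, c8, c9, c10, c11, c12, c13, c14] =
    comb [2 * c5, 2 * c3, 2 * c4, 2 * c1, 2 * c2, 2 * c0, 2 * c7, 2 * c6, 2 * c2 + 2 * c4 + 2 * c6 + 2 * c7, 2 * c10, 2 * c9, 2 * c1 + 2 * c3 + 2 * c9 + 2 * c10, 2 * c13, 2 * c12, 2 * c0 + 2 * c5 + 2 * c12 + 2 * c13]"
  by (simp only: Z_def mult.assoc distrib_right left_diff_distrib mult_scaleR_left comb_simps;
    simp add: algebra_simps)

text \<open>On permutations, up to terms with contractions, \<open>om\<close> is four times the sum
  of the 3-cycles minus twice the sum of the transpositions; this central element has the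
  eigenvalues \<open>2\<close>, \<open>14\<close>, \<open>- 4\<close>. On the nine remaining
  diagrams \<open>om\<close> acts as \<open>8\<close>.\<close>

lemma om_comb: "om * comb [c0, c1, c2, c3, c4, c5, c6, c7, c8, c9, c10, c11, c12, c13, c14] =
    comb [- 2 * c1 - 2 * c2 + 4 * c3 + 4 * c4 - 2 * c5, - 2 * c0 + 4 * c2 - 2 * c3 - 2 * c4 + 4 * c5, - 2 * c0 + 4 * c1 - 2 * c3 - 2 * c4 + 4 * c5, 4 * c0 - 2 * c1 - 2 * c2 + 4 * c4 - 2 * c5, 4 * c0 - 2 * c1 - 2 * c2 + 4 * c3 - 2 * c5, - 2 * c0 + 4 * c1 + 4 * c2 - 2 * c3 - 2 * c4, - 2 * c0 - 2 * c1 + 4 * c2 + 4 * c3 + 4 * c4 + 4 * c5 + 8 * c6, 4 * c0 + 4 * c1 + 4 * c2 - 2 * c3 + 4 * c4 - 2 * c5 + 8 * c7, 4 * c0 + 4 * c1 - 2 * c2 + 4 * c3 - 2 * c4 + 4 * c5 + 8 * c8, 4 * c0 + 4 * c1 + 4 * c2 + 4 * c3 - 2 * c4 - 2 * c5 + 8 * c9, - 2 * c0 + 4 * c1 - 2 * c2 + 4 * c3 + 4 * c4 + 4 * c5 + 8 * c10, 4 * c0 - 2 * c1 + 4 * c2 - 2 * c3 + 4 * c4 + 4 * c5 + 8 * c11, 4 * c0 + 4 * c1 - 2 * c2 - 2 * c3 + 4 * c4 + 4 * c5 + 8 * c12, 4 * c0 - 2 * c1 + 4 * c2 + 4 * c3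 - 2 * c4 + 4 * c5 + 8 * c13, - 2 * c0 + 4 * c1 + 4 * c2 + 4 * c3 + 4 * c4 - 2 * c5 + 8 * c14]"
  by (simp only: om_def mult.assoc distrib_right left_diff_distrib mult_scaleR_left comb_simps X_comb Y_comb Z_comb;
    simp add: algebra_simps)

lemmas generator_comb = X_comb Y_comb Z_comb om_comb comb_add comb_diff comb_scaleR

text \<open>An element is determined by its product with the unit, so each relation becomes a
  numerical computation that starts from one coefficient vector.\<close>

lemma eq_by_comb: "a * comb [1, 0, 0, 0, 0, 0, 0, 0, 0, 0, 0, 0, 0, 0, 0] = b * comb [1, 0, 0, 0, 0, 0, 0, 0, 0, 0, 0, 0, 0, 0, 0] \<Longrightarrow> a = b"
  by (simp only: unit flip: unit_eq_comb)

lemma Z_eq: "Z = 2 *\<^sub>R (s1 * (s2 + e2) * s1)"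
  by (rule eq_by_comb) (simp add: Z_comb mult.assoc distrib_right comb_simps)

lemma om_central: "om * X = X * om" "om * Y = Y * om" "om * Z = Z * om"
  by (rule eq_by_comb, simp add: mult.assoc generator_comb)+

lemma bannai_ito: "X * Y + Y * X = X + Y + Z + om" "X * Z + Z * X = X + Y + Z + om"
  "Y * Z + Z * Y = X + Y + Z + om"
  by (rule eq_by_comb, simp add: distrib_right mult.assoc generator_comb)+

lemma cubic: assumes "U \<in> {X, Y, Z}" shows "U * (U * U - 4 *\<^sub>R u) = 0"
proof -
  have "U * ((U * U - 4 *\<^sub>R u) * comb [1, 0, 0, 0, 0, 0, 0, 0, 0, 0, 0, 0, 0, 0, 0]) = 0"
    using assms
    by (elim insertE emptyE; hypsubst;
        simp add: zero_eq_comb left_diff_distrib mult.assoc generator_comb unit)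
  then show ?thesis by (simp only: unit flip: unit_eq_comb)
qed

lemma quartic: "(om + 4 *\<^sub>R u) * (om - 2 *\<^sub>R u) * (om - 8 *\<^sub>R u) * (om - 14 *\<^sub>R u) = 0"
proof -
  have "(om + 4 *\<^sub>R u) * ((om - 2 *\<^sub>R u) * ((om - 8 *\<^sub>R u) * ((om - 14 *\<^sub>R u) * comb [1, 0, 0, 0, 0, 0, 0, 0, 0, 0, 0, 0, 0, 0, 0]))) = 0"
    by (simp add: zero_eq_comb distrib_right left_diff_distrib generator_comb unit)
  then show ?thesis by (simp only: unit mult.assoc flip: unit_eq_comb)
qed

lemma degree_seven: assumes "U \<in> {X, Y, Z}"
  shows "(U - om + 16 *\<^sub>R u) * (U - om + 10 *\<^sub>R u) * (U - om + 8 *\<^sub>R u) *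
       (U - om + 6 *\<^sub>R u) * (U - om) * (U - om - 2 *\<^sub>R u) * (U - om - 6 *\<^sub>R u) = 0"
proof -
  have "(U - om + 16 *\<^sub>R u) * ((U - om + 10 *\<^sub>R u) * ((U - om + 8 *\<^sub>R u) * ((U - om + 6 *\<^sub>R u) *
      ((U - om) * ((U - om - 2 *\<^sub>R u) * ((U - om - 6 *\<^sub>R u) * comb [1, 0, 0, 0, 0, 0, 0, 0, 0, 0, 0, 0, 0, 0, 0])))))) = 0"
    using assms
    by (elim insertE emptyE; hypsubst;
        simp add: zero_eq_comb distrib_right left_diff_distrib generator_comb unit)
  then show ?thesis by (simp only: unit mult.assoc flip: unit_eq_comb)
qed

end

section \<open>The isomorphism\<close>

lemma free_lift_hom: "free_lift h \<in> algebra_hom free_algebra free_algebra"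
  by (auto simp: algebra_hom_def ring_hom_def free_lift_simps)

lemma algebra_hom_free:
  assumes "h \<in> algebra_hom free_algebra A"
  shows "h (a + b) = h a \<oplus>\<^bsub>A\<^esub> h b" "h (a * b) = h a \<otimes>\<^bsub>A\<^esub> h b" "h (scalar c * a) = c \<odot>\<^bsub>A\<^esub> h a"
    "h a \<in> carrier A"
  using assms by (auto simp: algebra_hom_def ring_hom_def)

lemma algebra_hom_free_diff:
  assumes "ring A" and h: "h \<in> algebra_hom free_algebra A"
  shows "h (a - b) = h a \<ominus>\<^bsub>A\<^esub> h b"
proof -
  interpret ring A by fact
  have "h a = h (a - b) \<oplus>\<^bsub>A\<^esub> h b"
    by (simp flip: algebra_hom_free(1)[OF h])
  then show ?thesis
    using algebra_hom_free(4)[OF h] by (simp add: a_minus_def a_assoc r_neg)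
qed

interpretation BI: presented_algebra free_algebra BI_rels
  rewrites "quotient_algebra free_algebra BI_rels = BI" and "quotient_class free_algebra BI_rels = BI_class"
  by unfold_locales (simp_all add: unital_algebra_free BI_def BI_class_def)

interpretation BI_bar: presented_algebra BI BI_bar_rels
  rewrites "quotient_algebra BI BI_bar_rels = BI_bar"
proof -
  show "presented_algebra BI BI_bar_rels"
    using BI.class_closed by unfold_locales (auto simp: BI.unital_algebra_quotient BI_bar_rels_def)
qed (simp add: BI_bar_def)

interpretation brauer: presented_algebra free_algebra "brauer3_rels (- 1)"
  rewrites "quotient_algebra free_algebra (brauer3_rels (- 1)) = brauer3 (- 1)"
  by unfold_locales (simp_all add: unital_algebra_free brauer3_def)

definition BI_bar_class :: "bi_gen free \<Rightarrow> bi_gen free set set" where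
  "BI_bar_class a = quotient_class BI BI_bar_rels (BI_class a)"

definition brauer_class :: "brauer_gen free \<Rightarrow> brauer_gen free set" where
  "brauer_class = quotient_class free_algebra (brauer3_rels (- 1))"

lemma BI_bar_class_hom: "BI_bar_class \<in> algebra_hom free_algebra BI_bar"
  using algebra_hom_compose[OF BI.class_hom BI_bar.class_hom]
  by (simp add: BI_bar_class_def[abs_def] comp_def)

lemma brauer_class_hom: "brauer_class \<in> algebra_hom free_algebra (brauer3 (- 1))"
  unfolding brauer_class_def by (rule brauer.class_hom)

text \<open>The quotient of a quotient becomes a single congruence on polynomials, so that
  \<open>bi_gen alg\<close> is a copy of \<open>BI_bar\<close> with type class arithmetic.\<close>

instantiation bi_gen :: relations
begin

definition "congruent_bi_gen a b \<longleftrightarrow> BI_bar_class a = BI_bar_class b"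

instance
  by standard (auto simp: congruent_bi_gen_def algebra_hom_free[OF BI_bar_class_hom]
      intro!: equivpI reflpI sympI transpI)

end

instantiation brauer_gen :: relations
begin

definition "congruent_brauer_gen a b \<longleftrightarrow> brauer_class a = brauer_class b"

instance
  by standard (auto simp: congruent_brauer_gen_def algebra_hom_free[OF brauer_class_hom]
      intro!: equivpI reflpI sympI transpI)

end

lemma BI_bar_class_eq_iff: "BI_bar_class a = BI_bar_class b \<longleftrightarrow> abs_alg a = abs_alg b"
  by (simp add: alg.abs_eq_iff congruent_bi_gen_def)

lemma brauer_class_eq_iff: "brauer_class a = brauer_class b \<longleftrightarrow> abs_alg a = abs_alg b"
  by (simp add: alg.abs_eq_iff congruent_brauer_gen_def)

lemma abs_alg_scalar_mult:
  fixes v :: "'a::relations alg"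
  shows "abs_alg (scalar (numeral k)) * v = numeral k *\<^sub>R v"
  "abs_alg (scalar (1/2)) * v = (1/2) *\<^sub>R v"
  "abs_alg (scalar (- 1)) * v = - v"
proof -
  have scalar: "abs_alg (scalar (complex_of_real r)) * v = r *\<^sub>R v" for r
    using abs_alg_scalar[of r "1 :: 'a free"] by (simp add: abs_alg_unit_left)
  show "abs_alg (scalar (numeral k)) * v = numeral k *\<^sub>R v"
    "abs_alg (scalar (1/2)) * v = (1/2) *\<^sub>R v" "abs_alg (scalar (- 1)) * v = - v"
    using scalar[of "numeral k"] scalar[of "1/2"] scalar[of "- 1"] by simp_all
qed

lemmas to_alg = abs_alg_simps abs_alg_scalar_mult abs_alg_numeral power2_eq_square

lemma BI_rel: "(l, r) \<in> BI_rels \<Longrightarrow> abs_alg l = abs_alg r"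
  by (simp add: BI.class_rel BI_bar_class_def flip: BI_bar_class_eq_iff)

lemma BI_bar_rel:
  assumes "(l, r) \<in> BI_bar_poly_rels"
  shows "abs_alg l = abs_alg r"
proof -
  have "(BI_class l, BI_class r) \<in> BI_bar_rels"
    unfolding BI_bar_rels_def using assms by (force simp: map_prod_def)
  from BI_bar.class_rel[OF this] show ?thesis
    by (simp add: BI_bar_class_def flip: BI_bar_class_eq_iff)
qed

lemma brauer_rel: "(l, r) \<in> brauer3_rels (- 1) \<Longrightarrow> abs_alg l = abs_alg r"
  by (simp add: brauer.class_rel brauer_class_def flip: brauer_class_eq_iff)

interpretation B: brauer_three "abs_alg (gen GS1)" "abs_alg (gen GS2)" "abs_alg (gen GE1)" "abs_alg (gen GE2)"
  "abs_alg 1"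
proof
  show "abs_alg 1 * v = v" "v * abs_alg 1 = v" for v :: "brauer_gen alg"
    by (simp_all add: abs_alg_unit_left abs_alg_unit_right)
qed (rule brauer_rel[of "gen GS1 ^ 2" "1", unfolded to_alg]
    brauer_rel[of "gen GS2 ^ 2" "1", unfolded to_alg]
    brauer_rel[of "gen GE1 ^ 2" "scalar (- 1) * gen GE1", unfolded to_alg]
    brauer_rel[of "gen GE2 ^ 2" "scalar (- 1) * gen GE2", unfolded to_alg]
    brauer_rel[of "gen GS1 * gen GE1" "gen GE1", unfolded to_alg]
    brauer_rel[of "gen GE1 * gen GS1" "gen GE1", unfolded to_alg]
    brauer_rel[of "gen GS2 * gen GE2" "gen GE2", unfolded to_alg]
    brauer_rel[of "gen GE2 * gen GS2" "gen GE2", unfolded to_alg]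
    brauer_rel[of "gen GS1 * gen GS2 * gen GS1" "gen GS2 * gen GS1 * gen GS2", unfolded to_alg]
    brauer_rel[of "gen GE1 * gen GE2 * gen GE1" "gen GE1", unfolded to_alg]
    brauer_rel[of "gen GE2 * gen GE1 * gen GE2" "gen GE2", unfolded to_alg]
    brauer_rel[of "gen GS1 * gen GE2 * gen GE1" "gen GS2 * gen GE1", unfolded to_alg]
    brauer_rel[of "gen GE2 * gen GE1 * gen GS2" "gen GE2 * gen GS1", unfolded to_alg],
    simp only: brauer3_rels_def Let_def power2_eq_square insert_iff simp_thms)+

text \<open>The three central generators share one image, which the first Bannai--Ito relation
  forces.\<close>

definition to_brauer :: "bi_gen \<Rightarrow> brauer_gen free" where
  "to_brauer g =
     (let X = scalar 2 * (gen GS1 + gen GE1); Y = scalar 2 * (gen GS2 + gen GE2);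
          Z = scalar 2 * (gen GS2 * (gen GS1 + gen GE1) * gen GS2)
      in case g of GX \<Rightarrow> X | GY \<Rightarrow> Y | GZ \<Rightarrow> Z | _ \<Rightarrow> X * Y + Y * X - X - Y - Z)"

fun from_brauer :: "brauer_gen \<Rightarrow> bi_gen free" where
  "from_brauer GS1 = 1 + scalar (1/2) * gen GX - (scalar (1/2) * gen GX) * (scalar (1/2) * gen GX)"
| "from_brauer GS2 = 1 + scalar (1/2) * gen GY - (scalar (1/2) * gen GY) * (scalar (1/2) * gen GY)"
| "from_brauer GE1 = (scalar (1/2) * gen GX) * (scalar (1/2) * gen GX) - 1"
| "from_brauer GE2 = (scalar (1/2) * gen GY) * (scalar (1/2) * gen GY) - 1"

lemma abs_to_brauer:
  "abs_alg (to_brauer GX) = B.X" "abs_alg (to_brauer GY) = B.Y" "abs_alg (to_brauer GZ) = B.Z"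
  "g \<in> {GomX, GomY, GomZ} \<Longrightarrow> abs_alg (to_brauer g) = B.om"
  by (auto simp: to_brauer_def Let_def to_alg B.X_def B.Y_def B.Z_def B.om_def)

lemma to_brauer_BI_rels:
  assumes "(l, r) \<in> BI_rels"
  shows "abs_alg (free_lift to_brauer l) = abs_alg (free_lift to_brauer r)"
proof -
  have "B.om * abs_alg (to_brauer g) = abs_alg (to_brauer g) * B.om" for g
    by (cases g) (simp_all add: abs_to_brauer B.om_central)
  then show ?thesis
    using assms by (auto simp: BI_rels_def Let_def free_lift_simps to_alg abs_to_brauer B.bannai_ito)
qed

lemma to_brauer_BI_bar_rels:
  assumes "(l, r) \<in> BI_bar_poly_rels"
  shows "abs_alg (free_lift to_brauer l) = abs_alg (free_lift to_brauer r)"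
  using assms
  by (auto simp: BI_bar_poly_rels_def Let_def free_lift_simps to_alg abs_to_brauer
      B.cubic B.quartic B.degree_seven)

lemma om_eq: "abs_alg (gen GomY) = abs_alg (gen GomX)" "abs_alg (gen GomZ) = abs_alg (gen GomX)"
  by (rule BI_bar_rel[symmetric], simp add: BI_bar_poly_rels_def Let_def)+

lemma bannai_ito_bar:
  shows "abs_alg (gen GX) * abs_alg (gen GY) + abs_alg (gen GY) * abs_alg (gen GX) =
      abs_alg (gen GX) + abs_alg (gen GY) + abs_alg (gen GZ) + abs_alg (gen GomX)"
    and "abs_alg (gen GX) * abs_alg (gen GZ) + abs_alg (gen GZ) * abs_alg (gen GX) =
      abs_alg (gen GX) + abs_alg (gen GY) + abs_alg (gen GZ) + abs_alg (gen GomX)"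
    and "abs_alg (gen GY) * abs_alg (gen GZ) + abs_alg (gen GZ) * abs_alg (gen GY) =
      abs_alg (gen GX) + abs_alg (gen GY) + abs_alg (gen GZ) + abs_alg (gen GomX)"
  using BI_rel[of "gen GX * gen GY + gen GY * gen GX" "gen GX + gen GY + gen GZ + gen GomZ"]
    BI_rel[of "gen GX * gen GZ + gen GZ * gen GX" "gen GX + gen GY + gen GZ + gen GomY"]
    BI_rel[of "gen GY * gen GZ + gen GZ * gen GY" "gen GX + gen GY + gen GZ + gen GomX"]
  by (simp_all add: BI_rels_def Let_def to_alg om_eq)

lemma cubic_bar:
  assumes "g \<in> {GX, GY, GZ}"
  shows "abs_alg (gen g) * (abs_alg (gen g) * abs_alg (gen g) - 4 *\<^sub>R abs_alg 1) = 0"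
  using BI_bar_rel[of "gen g * (gen g ^ 2 - 4)" 0] assms
  by (auto simp: BI_bar_poly_rels_def Let_def to_alg)

lemma block_bar:
  "brauer_block (abs_alg 1) ((1/2) *\<^sub>R abs_alg (gen GX)) ((1/2) *\<^sub>R abs_alg (gen GY)) ((1/2) *\<^sub>R abs_alg (gen GZ))"
proof (rule bi_bar_brauer_block)
  show "abs_alg 1 * v = v" "v * abs_alg 1 = v" for v :: "bi_gen alg"
    by (simp_all add: abs_alg_unit_left abs_alg_unit_right)
  have "abs_alg (gen GomX * gen g) = abs_alg (gen g * gen GomX)" for g
    by (rule BI_rel) (auto simp: BI_rels_def Let_def)
  then show "abs_alg (gen GomX) * abs_alg (gen GX) = abs_alg (gen GX) * abs_alg (gen GomX)"
    "abs_alg (gen GomX) * abs_alg (gen GY) = abs_alg (gen GY) * abs_alg (gen GomX)"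
    "abs_alg (gen GomX) * abs_alg (gen GZ) = abs_alg (gen GZ) * abs_alg (gen GomX)"
    by (simp_all only: to_alg)
  note rels = BI_bar_rel[unfolded BI_bar_poly_rels_def Let_def]
  show "abs_alg (gen GX) * (abs_alg (gen GX) * abs_alg (gen GX) - 4 *\<^sub>R abs_alg 1) = 0"
    "abs_alg (gen GY) * (abs_alg (gen GY) * abs_alg (gen GY) - 4 *\<^sub>R abs_alg 1) = 0"
    "abs_alg (gen GZ) * (abs_alg (gen GZ) * abs_alg (gen GZ) - 4 *\<^sub>R abs_alg 1) = 0"
    by (rule cubic_bar; simp)+
  let ?om = "gen GomX"
  show "(abs_alg ?om + 4 *\<^sub>R abs_alg 1) * (abs_alg ?om - 2 *\<^sub>R abs_alg 1) *
      (abs_alg ?om - 8 *\<^sub>R abs_alg 1) * (abs_alg ?om - 14 *\<^sub>R abs_alg 1) = 0"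
    using rels[of "(?om + 4) * (?om - 2) * (?om - 8) * (?om - 14)" 0] by (simp add: to_alg)
  have "(abs_alg (gen g) - abs_alg ?om + 16 *\<^sub>R abs_alg 1) * (abs_alg (gen g) - abs_alg ?om + 10 *\<^sub>R abs_alg 1) *
      (abs_alg (gen g) - abs_alg ?om + 8 *\<^sub>R abs_alg 1) * (abs_alg (gen g) - abs_alg ?om + 6 *\<^sub>R abs_alg 1) *
      (abs_alg (gen g) - abs_alg ?om) * (abs_alg (gen g) - abs_alg ?om - 2 *\<^sub>R abs_alg 1) *
      (abs_alg (gen g) - abs_alg ?om - 6 *\<^sub>R abs_alg 1) = 0"
    if "g \<in> {GX, GY, GZ}" for g
    using rels[of "(gen g - ?om + 16) * (gen g - ?om + 10) * (gen g - ?om + 8) * (gen g - ?om + 6)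
              * (gen g - ?om) * (gen g - ?om - 2) * (gen g - ?om - 6)" 0] that
    by (auto simp: to_alg)
  then show "(U - abs_alg ?om + 16 *\<^sub>R abs_alg 1) * (U - abs_alg ?om + 10 *\<^sub>R abs_alg 1) *
      (U - abs_alg ?om + 8 *\<^sub>R abs_alg 1) * (U - abs_alg ?om + 6 *\<^sub>R abs_alg 1) *
      (U - abs_alg ?om) * (U - abs_alg ?om - 2 *\<^sub>R abs_alg 1) *
      (U - abs_alg ?om - 6 *\<^sub>R abs_alg 1) = 0"
    if "U \<in> {abs_alg (gen GX), abs_alg (gen GY), abs_alg (gen GZ)}" for U
    using that by blast
qed (fact bannai_ito_bar)+

text \<open>Modulo \<open>x^3 = x\<close> a polynomial is known from its values at \<open>0\<close>,
  \<open>1\<close>, \<open>- 1\<close>: these are \<open>1\<close>, \<open>1\<close>,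
  \<open>- 1\<close> for the reflection and \<open>- 1\<close>, \<open>0\<close>, \<open>0\<close>
  for the contraction.\<close>

lemma reflection_square:
  fixes x u :: "'a::real_algebra"
  assumes "x * (x * x) = x" "\<And>v. u * v = v" "\<And>v. v * u = v"
  shows "(u + x - x * x) * (u + x - x * x) = u" "(x * x - u) * (x * x - u) = - (x * x - u)"
    "(u + x - x * x) * (x * x - u) = x * x - u" "(x * x - u) * (u + x - x * x) = x * x - u"
proof -
  have "x * (x * (x * x)) = x * x"
    by (simp only: assms)
  then show "(u + x - x * x) * (u + x - x * x) = u" "(x * x - u) * (x * x - u) = - (x * x - u)"
    "(u + x - x * x) * (x * x - u) = x * x - u" "(x * x - u) * (u + x - x * x) = x * x - u"
    by (simp_all add: algebra_simps assms)
qed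

text \<open>With \<open>s3\<close>, \<open>e3\<close> formed from \<open>z\<close>, the conjugation
  clauses give \<open>s1 s2 = s3 s1\<close>, \<open>s2 s1 = s3 s2\<close> and the same for
  contractions. Both sides of the braid relation are then \<open>s3\<close>, while
  \<open>s1 e2 e1 = e3 s1 e1 = e3 e1\<close> and \<open>e2 e1 s2 = e2 s2 e3 = e2 e3\<close>.\<close>

lemma brauer_relations_of_block:
  fixes x y z u :: "'a::real_algebra"
  assumes unit: "\<And>v. u * v = v" "\<And>v. v * u = v"
    and cube: "x * (x * x) = x" "y * (y * y) = y"
    and block: "brauer_block u x y z"
  defines "s1 \<equiv> u + x - x * x" and "s2 \<equiv> u + y - y * y" and "e1 \<equiv> x * x - u" and "e2 \<equiv> y * y - u"
  shows "brauer_three s1 s2 e1 e2 u" and "s2 * x * s2 = z"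
proof -
  note x = reflection_square[OF cube(1) unit, folded s1_def e1_def]
  note y = reflection_square[OF cube(2) unit, folded s2_def e2_def]
  define s3 e3 where "s3 = u + z - z * z" and "e3 = z * z - u"
  note b = block[unfolded brauer_block_def, folded s1_def s2_def e1_def e2_def e3_def]
  have sy: "s1 * y = z * s1" and sx: "s2 * x = z * s2"
    using b by blast+
  have s_mult: "s1 * (s1 * w) = w" "s2 * (s2 * w) = w" for w
    by (simp_all only: x(1) y(1) unit flip: mult.assoc)
  have conj_mult: "s1 * (y * w) = z * (s1 * w)" "s2 * (x * w) = z * (s2 * w)" for w
    by (simp_all only: sy sx flip: mult.assoc)
  have conj: "s1 * s2 = s3 * s1" "s1 * e2 = e3 * s1"
    unfolding s2_def e2_def s3_def e3_def
    by (simp_all only: distrib_left distrib_right right_diff_distrib left_diff_distrib mult.assoc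
        unit sy conj_mult)
  have conj': "s2 * s1 = s3 * s2" "s2 * e1 = e3 * s2"
    unfolding s1_def e1_def s3_def e3_def
    by (simp_all only: distrib_left distrib_right right_diff_distrib left_diff_distrib mult.assoc
        unit sx conj_mult)
  have e3: "s2 * e3 = e1 * s2"
  proof -
    have "s2 * e3 = s2 * (s2 * e1) * s2"
      by (simp only: conj' mult.assoc y(1) unit)
    then show ?thesis
      by (simp only: s_mult)
  qed
  have e_mult: "e3 * e1 = s2 * e1" "e2 * e3 = e2 * s1" "e1 * e2 * e1 = e1" "e2 * e1 * e2 = e2"
    using b by blast+
  show "s2 * x * s2 = z"
    by (simp add: sx mult.assoc y(1) unit)
  show "brauer_three s1 s2 e1 e2 u"
  proof
    show "s1 * s2 * s1 = s2 * s1 * s2"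
      by (simp only: conj conj' mult.assoc x(1) y(1))
    show "s1 * e2 * e1 = s2 * e1"
      by (simp only: conj mult.assoc x(3)) (rule e_mult)
    have "e2 * e1 * s2 = e2 * s2 * e3"
      by (simp only: mult.assoc e3)
    then show "e2 * e1 * s2 = e2 * s1"
      by (simp only: y(4) e_mult)
  qed (simp_all add: unit x y e_mult)
qed

lemma half_cube:
  assumes "g \<in> {GX, GY, GZ}"
  shows "((1/2) *\<^sub>R abs_alg (gen g)) * (((1/2) *\<^sub>R abs_alg (gen g)) * ((1/2) *\<^sub>R abs_alg (gen g))) =
    (1/2) *\<^sub>R abs_alg (gen g)"
  using cubic_bar[OF assms] by (simp add: right_diff_distrib abs_alg_unit_right)

lemma from_brauer_three:
  "brauer_three (abs_alg (from_brauer GS1)) (abs_alg (from_brauer GS2))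
     (abs_alg (from_brauer GE1)) (abs_alg (from_brauer GE2)) (abs_alg 1)"
  and from_brauer_conj: "abs_alg (from_brauer GS2) * ((1/2) *\<^sub>R abs_alg (gen GX)) * abs_alg (from_brauer GS2) =
    (1/2) *\<^sub>R abs_alg (gen GZ)"
  using brauer_relations_of_block[OF abs_alg_unit_left abs_alg_unit_right half_cube[OF insertI1]
      half_cube[OF insertI2[OF insertI1]] block_bar]
  by (simp_all only: from_brauer.simps to_alg)

lemma from_brauer_rels:
  assumes "(l, r) \<in> brauer3_rels (- 1)"
  shows "abs_alg (free_lift from_brauer l) = abs_alg (free_lift from_brauer r)"
proof -
  note b = from_brauer_three[unfolded brauer_three_def]
  show ?thesis
    using assms b
    by (auto simp: brauer3_rels_def Let_def free_lift_simps to_alg simp del: from_brauer.simps)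
qed

text \<open>On generators: \<open>s + e = x\<close> returns \<open>X\<close> and \<open>Y\<close>,
  \<open>from_brauer_conj\<close> returns \<open>Z\<close>, and the first Bannai--Ito relation
  returns the central generators.\<close>

lemma from_to_brauer: "abs_alg (free_lift from_brauer (free_lift to_brauer a)) = abs_alg a"
proof (induction a rule: free_induct)
  case (gen g)
  have sum: "abs_alg (from_brauer GS1) + abs_alg (from_brauer GE1) = (1/2) *\<^sub>R abs_alg (gen GX)"
    "abs_alg (from_brauer GS2) + abs_alg (from_brauer GE2) = (1/2) *\<^sub>R abs_alg (gen GY)"
    by (simp_all add: to_alg)
  have gens: "abs_alg (free_lift from_brauer (to_brauer GX)) = abs_alg (gen GX)"
    "abs_alg (free_lift from_brauer (to_brauer GY)) = abs_alg (gen GY)"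
    "abs_alg (free_lift from_brauer (to_brauer GZ)) = abs_alg (gen GZ)"
    by (simp_all only: to_brauer_def Let_def bi_gen.case free_lift_simps free_lift_gen free_lift_scalar
        to_alg sum from_brauer_conj) simp_all
  moreover have "abs_alg (free_lift from_brauer (to_brauer h)) = abs_alg (gen h)" if "h \<in> {GomX, GomY, GomZ}" for h
  proof -
    have h: "to_brauer h = to_brauer GX * to_brauer GY + to_brauer GY * to_brauer GX
        - to_brauer GX - to_brauer GY - to_brauer GZ"
      using that by (auto simp: to_brauer_def Let_def)
    have "abs_alg (gen h) = abs_alg (gen GomX)"
      using that om_eq by auto
    then show ?thesis
      unfolding h using bannai_ito_bar(1) by (simp add: free_lift_simps to_alg gens)
  qed
  ultimately show ?case
    by (cases g) simp_all
qed (simp_all add: free_lift_simps to_alg)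

lemma to_from_brauer: "abs_alg (free_lift to_brauer (free_lift from_brauer a)) = abs_alg a"
proof (induction a rule: free_induct)
  case (gen g)
  have X: "(1/2) *\<^sub>R B.X = abs_alg (gen GS1) + abs_alg (gen GE1)"
    and Y: "(1/2) *\<^sub>R B.Y = abs_alg (gen GS2) + abs_alg (gen GE2)"
    by (simp_all add: B.X_def B.Y_def)
  show ?case
    by (cases g; simp only: from_brauer.simps free_lift_simps free_lift_gen free_lift_scalar free_lift_1
        to_alg abs_to_brauer X Y)
      (simp_all add: distrib_left distrib_right B.s_square B.e_square B.se)
qed (simp_all add: free_lift_simps to_alg)

theorem theorem2p1:
  fixes B :: "(complex, brauer_gen free set) module" (structure)
    and X Y Z om :: "bi_gen free set set"
    and s1 s2 e1 e2 :: "brauer_gen free set"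
  defines "B \<equiv> brauer3 (-1)"
    and "X \<equiv> BI_bar_gen GX" and "Y \<equiv> BI_bar_gen GY" and "Z \<equiv> BI_bar_gen GZ"
    and "om \<equiv> BI_bar_gen GomX"
    and "s1 \<equiv> brauer3_gen (-1) GS1" and "s2 \<equiv> brauer3_gen (-1) GS2"
    and "e1 \<equiv> brauer3_gen (-1) GE1" and "e2 \<equiv> brauer3_gen (-1) GE2"
  shows "\<exists>\<Psi> \<in> algebra_iso BI_bar B.
           \<Psi> X = 2 \<odot> (s1 \<oplus> e1) \<and>
           \<Psi> Y = 2 \<odot> (s2 \<oplus> e2) \<and>
           \<Psi> Z = 2 \<odot> (s2 \<otimes> (s1 \<oplus> e1) \<otimes> s2) \<and>
           \<Psi> Z = 2 \<odot> (s1 \<otimes> (s2 \<oplus> e2) \<otimes> s1) \<and>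
           \<Psi> om = anticomm B (\<Psi> X) (\<Psi> Y) \<ominus> \<Psi> X \<ominus> \<Psi> Y \<ominus> \<Psi> Z"
proof -
  note hom = brauer_class_hom[folded B_def]
  have algB: "unital_algebra B" and algBI: "unital_algebra BI_bar"
    unfolding B_def by (rule brauer.unital_algebra_quotient BI_bar.unital_algebra_quotient)+
  then have ringB: "ring B"
    by (simp add: unital_algebra_def)
  have to_hom: "brauer_class \<circ> free_lift to_brauer \<in> algebra_hom free_algebra B"
    by (rule algebra_hom_compose[OF free_lift_hom hom])
  have from_hom: "BI_bar_class \<circ> free_lift from_brauer \<in> algebra_hom free_algebra BI_bar"
    by (rule algebra_hom_compose[OF free_lift_hom BI_bar_class_hom])
  \<comment> \<open>The source is a quotient of a quotient, so the substitution is factored twice: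
    over the Bannai--Ito relations, then over the images of the additional relations under
    \<open>BI_class\<close>.\<close>
  obtain \<Psi>0 where \<Psi>0: "\<Psi>0 \<in> algebra_hom BI B"
      "\<And>a. \<Psi>0 (BI_class a) = brauer_class (free_lift to_brauer a)"
    by (rule BI.hom_factors[OF algB to_hom]) (simp_all add: to_brauer_BI_rels brauer_class_eq_iff)
  obtain \<Psi> where \<Psi>: "\<Psi> \<in> algebra_hom BI_bar B"
      "\<And>a. \<Psi> (BI_bar_class a) = brauer_class (free_lift to_brauer a)"
  proof (rule BI_bar.hom_factors[OF algB \<Psi>0(1)])
    show "\<Psi>0 l = \<Psi>0 r" if "(l, r) \<in> BI_bar_rels" for l r
    proof -
      obtain a b where ab: "(a, b) \<in> BI_bar_poly_rels" "l = BI_class a" "r = BI_class b"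
        using \<open>(l, r) \<in> BI_bar_rels\<close> by (auto simp: BI_bar_rels_def)
      show ?thesis
        by (simp add: ab(2,3) \<Psi>0(2) brauer_class_eq_iff to_brauer_BI_bar_rels[OF ab(1)])
    qed
  next
    fix \<Psi> assume *: "\<Psi> \<in> algebra_hom BI_bar B"
      "\<And>K. K \<in> carrier BI \<Longrightarrow> \<Psi> (quotient_class BI BI_bar_rels K) = \<Psi>0 K"
    have "\<Psi> (BI_bar_class a) = brauer_class (free_lift to_brauer a)" for a
      by (simp add: BI_bar_class_def *(2) BI.class_closed \<Psi>0(2))
    with *(1) show thesis by (rule that)
  qed
  obtain \<Phi> where \<Phi>: "\<Phi> \<in> algebra_hom B BI_bar"
      "\<And>b. \<Phi> (brauer_class b) = BI_bar_class (free_lift from_brauer b)"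
    by (rule brauer.hom_factors[OF algBI from_hom, folded brauer_class_def B_def])
      (simp_all add: from_brauer_rels BI_bar_class_eq_iff)
  have carrier_BI: "carrier BI_bar = range BI_bar_class"
    by (simp add: BI_bar.class_surj BI.class_surj image_image BI_bar_class_def[abs_def])
  have carrier_B: "carrier B = range brauer_class"
    by (simp add: B_def brauer.class_surj brauer_class_def)
  have "bij_betw \<Psi> (carrier BI_bar) (carrier B)"
  proof (rule bij_betw_byWitness[where f' = \<Phi>])
    show "\<forall>a\<in>carrier BI_bar. \<Phi> (\<Psi> a) = a"
      by (auto simp: carrier_BI \<Psi>(2) \<Phi>(2) BI_bar_class_eq_iff from_to_brauer)
    show "\<forall>b\<in>carrier B. \<Psi> (\<Phi> b) = b"
      by (auto simp: carrier_B \<Psi>(2) \<Phi>(2) brauer_class_eq_iff to_from_brauer)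
  qed (use algebra_hom_closed[OF \<Psi>(1)] algebra_hom_closed[OF \<Phi>(1)] in auto)
  with \<Psi>(1) have iso: "\<Psi> \<in> algebra_iso BI_bar B"
    by (simp add: algebra_iso_def algebra_hom_def ring_iso_def)
  have gens: "X = BI_bar_class (gen GX)" "Y = BI_bar_class (gen GY)" "Z = BI_bar_class (gen GZ)"
    "om = BI_bar_class (gen GomX)"
    "s1 = brauer_class (gen GS1)" "s2 = brauer_class (gen GS2)"
    "e1 = brauer_class (gen GE1)" "e2 = brauer_class (gen GE2)"
    by (simp_all add: X_def Y_def Z_def om_def s1_def s2_def e1_def e2_def BI_bar_gen_def
        BI_bar_class_def brauer3_gen_def brauer_class_def)
  have \<Psi>_gen: "\<Psi> (BI_bar_class (gen g)) = brauer_class (to_brauer g)" for g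
    by (simp add: \<Psi>(2))
  have Z': "brauer_class (to_brauer GZ) =
      brauer_class (scalar 2 * (gen GS1 * (gen GS2 + gen GE2) * gen GS1))"
    by (simp add: brauer_class_eq_iff abs_to_brauer B.Z_eq to_alg)
  note push = algebra_hom_free[OF hom] algebra_hom_free_diff[OF ringB hom]
  show ?thesis
  proof (intro bexI[OF _ iso] conjI)
    show "\<Psi> X = 2 \<odot> (s1 \<oplus> e1)" "\<Psi> Y = 2 \<odot> (s2 \<oplus> e2)"
      "\<Psi> Z = 2 \<odot> (s2 \<otimes> (s1 \<oplus> e1) \<otimes> s2)"
      by (simp_all only: gens \<Psi>_gen to_brauer_def Let_def bi_gen.case push(3))
        (simp_all only: push(1,2))
    show "\<Psi> Z = 2 \<odot> (s1 \<otimes> (s2 \<oplus> e2) \<otimes> s1)"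
      by (simp only: gens \<Psi>_gen Z' push(3)) (simp only: push(1,2))
    have om: "to_brauer GomX = to_brauer GX * to_brauer GY + to_brauer GY * to_brauer GX
        - to_brauer GX - to_brauer GY - to_brauer GZ"
      by (simp add: to_brauer_def Let_def)
    show "\<Psi> om = anticomm B (\<Psi> X) (\<Psi> Y) \<ominus> \<Psi> X \<ominus> \<Psi> Y \<ominus> \<Psi> Z"
      by (simp add: gens \<Psi>_gen om anticomm_def push)
  qed
qed

end
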